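(* Let $1<p<\infty$ and let $T\in\mathcal L(\ell_p)$. Then $$W_e(T)=V\bigl(\pi(T),\mathcal L(\ell_p)/\mathcal K(\ell_p)\bigr),$$ where the Calkin algebra $\mathcal L(\ell_p)/\mathcal K(\ell_p)$ is equipped with the usual quotient norm.
   Context: $\ell_p=\ell_p(\mathbb N)$ is the complex sequence space, $\mathcal L(\ell_p)$ its algebra of bounded linear operators, $\mathcal K(\ell_p)$ the ideal of compact operators, and $\pi:\mathcal L(\ell_p)\to\mathcal L(\ell_p)/\mathcal K(\ell_p)$ the quotient map. For a unital Banach algebra $\mathcal A$ with unit $1_{\mathcal A}$ and $a\in\mathcal A$, the algebraic numerical range is $V(a,\mathcal A)=\{f(a): f\in\mathcal A^*,\ \|f\|=1=f(1_{\mathcal A})\}$, where $\mathcal A^*$ is the Banach space dual. With $1/p+1/q=1$, the dual $(\ell_p)^*$ is identified with $\ell_q$ via $\langle x,y\rangle=\sum_j x_j\overline{y_j}$. For $x=(x_j)\in\ell_p$ put $J(x)=(x_j|x_j|^{p-2})_j\in\ell_q$ (with $0$ in the coordinates where $x_j=0$). The essential numerical range $W_e(T)$ is the set of all $\lambda\in\mathbb C$ for which there is a net (equivalently, a sequence) of unit vectors $x_\alpha\in\ell_p$ with $x_\alpha\to0$ weakly and $\langle Tx_\alpha,J(x_\alpha)\rangle\to\lambda$. *)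

theory Defs
  imports "HOL-Analysis.Analysis" "HOL-Algebra.Module" "HOL-Algebra.QuotRing"
begin

definition lp :: "real \<Rightarrow> (nat \<Rightarrow> complex) set" where
  "lp p = {x. summable (\<lambda>j. cmod (x j) powr p)}"

definition lp_norm :: "real \<Rightarrow> (nat \<Rightarrow> complex) \<Rightarrow> real" where
  "lp_norm p x = (\<Sum>j. cmod (x j) powr p) powr (1 / p)"

definition seq_add :: "(nat \<Rightarrow> complex) \<Rightarrow> (nat \<Rightarrow> complex) \<Rightarrow> nat \<Rightarrow> complex" where
  "seq_add x y = (\<lambda>j. x j + y j)"

definition seq_scale :: "complex \<Rightarrow> (nat \<Rightarrow> complex) \<Rightarrow> nat \<Rightarrow> complex" where
  "seq_scale c x = (\<lambda>j. c * x j)"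

definition lp_topology :: "real \<Rightarrow> (nat \<Rightarrow> complex) topology" where
  "lp_topology p = Metric_space.mtopology (lp p) (\<lambda>x y. lp_norm p (\<lambda>j. x j - y j))"

text \<open>The Banach space dual, and its norm, of the complex normed space with carrier \<open>V\<close>,
  addition \<open>pl\<close>, scalar multiplication \<open>sc\<close> and norm \<open>nm\<close>. The values of a functional
  outside \<open>V\<close> are irrelevant.\<close>

definition dual_space ::
    "'a set \<Rightarrow> ('a \<Rightarrow> 'a \<Rightarrow> 'a) \<Rightarrow> (complex \<Rightarrow> 'a \<Rightarrow> 'a) \<Rightarrow> ('a \<Rightarrow> real) \<Rightarrow> ('a \<Rightarrow> complex) set" where
  "dual_space V pl sc nm =
     {f. (\<forall>x\<in>V. \<forall>y\<in>V. f (pl x y) = f x + f y) \<and>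
         (\<forall>c. \<forall>x\<in>V. f (sc c x) = c * f x) \<and>
         (\<exists>C. \<forall>x\<in>V. cmod (f x) \<le> C * nm x)}"

definition dual_norm :: "'a set \<Rightarrow> ('a \<Rightarrow> real) \<Rightarrow> ('a \<Rightarrow> complex) \<Rightarrow> real" where
  "dual_norm V nm f = (SUP x\<in>{x \<in> V. nm x \<le> 1}. cmod (f x))"

record 'a normed_algebra = "(complex, 'a) module" +
  alg_norm :: "'a \<Rightarrow> real"

definition alg_numerical_range :: "'a \<Rightarrow> ('a, 'm) normed_algebra_scheme \<Rightarrow> complex set" where
  "alg_numerical_range a A =
     {f a | f. f \<in> dual_space (carrier A) (add A) (Module.smult A) (alg_norm A) \<and>
               dual_norm (carrier A) (alg_norm A) f = 1 \<and> f \<one>\<^bsub>A\<^esub> = 1}"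

text \<open>The quotient ring \<open>A Quot I\<close> made into a normed algebra. As in the library's
  multiplication of cosets, the scalar multiple of a coset is a union of cosets
  (all equal); the plain image would be wrong for the scalar zero.\<close>

definition quotient_algebra ::
    "('a, 'm) normed_algebra_scheme \<Rightarrow> 'a set \<Rightarrow> 'a set normed_algebra" where
  "quotient_algebra A I =
     \<lparr>carrier = carrier (A Quot I), mult = mult (A Quot I), one = one (A Quot I),
      zero = zero (A Quot I), add = add (A Quot I),
      smult = (\<lambda>c X. \<Union>a\<in>X. I +>\<^bsub>A\<^esub> (Module.smult A c a)),
      alg_norm = (\<lambda>X. INF a\<in>X. alg_norm A a)\<rparr>"

text \<open>Operators are functions on \<open>lp p\<close>, extended by \<open>undefined\<close> outside, so that equality
  of operators is equality of functions.\<close>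

definition lp_operators :: "real \<Rightarrow> ((nat \<Rightarrow> complex) \<Rightarrow> (nat \<Rightarrow> complex)) set" where
  "lp_operators p =
     {T \<in> lp p \<rightarrow>\<^sub>E lp p.
        (\<forall>x\<in>lp p. \<forall>y\<in>lp p. T (seq_add x y) = seq_add (T x) (T y)) \<and>
        (\<forall>c. \<forall>x\<in>lp p. T (seq_scale c x) = seq_scale c (T x)) \<and>
        (\<exists>C. \<forall>x\<in>lp p. lp_norm p (T x) \<le> C * lp_norm p x)}"

definition lp_operator_algebra ::
    "real \<Rightarrow> ((nat \<Rightarrow> complex) \<Rightarrow> (nat \<Rightarrow> complex)) normed_algebra" where
  "lp_operator_algebra p =
     \<lparr>carrier = lp_operators p,
      mult = (\<lambda>S T. compose (lp p) S T),
      one = (\<lambda>x\<in>lp p. x),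
      zero = (\<lambda>x\<in>lp p. (\<lambda>j. 0)),
      add = (\<lambda>S T. \<lambda>x\<in>lp p. seq_add (S x) (T x)),
      smult = (\<lambda>c T. \<lambda>x\<in>lp p. seq_scale c (T x)),
      alg_norm = (\<lambda>T. SUP x\<in>{x \<in> lp p. lp_norm p x \<le> 1}. lp_norm p (T x))\<rparr>"

definition lp_compact_operators :: "real \<Rightarrow> ((nat \<Rightarrow> complex) \<Rightarrow> (nat \<Rightarrow> complex)) set" where
  "lp_compact_operators p =
     {T \<in> lp_operators p.
        compactin (lp_topology p)
          (lp_topology p closure_of (T ` {x \<in> lp p. lp_norm p x \<le> 1}))}"

definition calkin_algebra ::
    "real \<Rightarrow> ((nat \<Rightarrow> complex) \<Rightarrow> (nat \<Rightarrow> complex)) set normed_algebra" where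
  "calkin_algebra p = quotient_algebra (lp_operator_algebra p) (lp_compact_operators p)"

definition calkin_proj ::
    "real \<Rightarrow> ((nat \<Rightarrow> complex) \<Rightarrow> (nat \<Rightarrow> complex)) \<Rightarrow> ((nat \<Rightarrow> complex) \<Rightarrow> (nat \<Rightarrow> complex)) set" where
  "calkin_proj p T = lp_compact_operators p +>\<^bsub>lp_operator_algebra p\<^esub> T"

definition seq_pairing :: "(nat \<Rightarrow> complex) \<Rightarrow> (nat \<Rightarrow> complex) \<Rightarrow> complex" where
  "seq_pairing x y = (\<Sum>j. x j * cnj (y j))"

definition duality_map :: "real \<Rightarrow> (nat \<Rightarrow> complex) \<Rightarrow> nat \<Rightarrow> complex" where
  "duality_map p x = (\<lambda>j. x j * complex_of_real (cmod (x j) powr (p - 2)))"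

definition lp_weakly_null :: "real \<Rightarrow> (nat \<Rightarrow> nat \<Rightarrow> complex) \<Rightarrow> bool" where
  "lp_weakly_null p x \<longleftrightarrow>
     (\<forall>\<phi>\<in>dual_space (lp p) seq_add seq_scale (lp_norm p). (\<lambda>n. \<phi> (x n)) \<longlonglongrightarrow> 0)"

definition essential_numerical_range ::
    "real \<Rightarrow> ((nat \<Rightarrow> complex) \<Rightarrow> (nat \<Rightarrow> complex)) \<Rightarrow> complex set" where
  "essential_numerical_range p T =
     {l. \<exists>x :: nat \<Rightarrow> nat \<Rightarrow> complex.
           (\<forall>n. x n \<in> lp p \<and> lp_norm p (x n) = 1) \<and>
           lp_weakly_null p x \<and>
           (\<lambda>n. seq_pairing (T (x n)) (duality_map p (x n))) \<longlonglongrightarrow> l}"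

end

theory Submission
  imports Defs "HOL-Real_Asymp.Real_Asymp"
begin

text \<open>
  The algebraic numerical range consists of the values at \<open>T\<close> of the states of the Calkin algebra, that is,
  of the unital functionals of norm one on the operators that annihilate the compact ones
  (\<open>calkin_numerical_range\<close>). Below, \<open>J\<close> is the duality map; it is positively homogeneous of degree
  \<open>p - 1\<close> and commutes with restriction to a set of coordinates.

  A weakly null sequence of unit vectors \<open>x\<^sub>n\<close> gives a state as a cluster point of the functionals
  \<open>S \<mapsto> \<langle>S x\<^sub>n, J x\<^sub>n\<rangle>\<close>, which exists by Tychonoff's theorem. It annihilates the compact operators because
  they map \<open>x\<^sub>n\<close> to a norm null sequence (\<open>calkin_state_of_weakly_null\<close>). This is the inclusion of the
  essential numerical range in the algebraic one.

  For the converse let \<open>W\<close> be the set of all numbers that are, for every \<open>N\<close>, limits of values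
  \<open>\<langle>T x, J x\<rangle>\<close> at unit vectors \<open>x\<close> with finite support beyond \<open>N\<close>. Such vectors can be chosen to be weakly
  null, so \<open>W\<close> is contained in the essential numerical range. The set \<open>W\<close> is closed, and it is convex:
  two vectors with disjoint supports far from each other are joined to one, and the mixed terms are
  negligible (\<open>tail_values_convex\<close>). If the value of a state at \<open>T\<close> were outside \<open>W\<close>, a line would
  separate it from the values at all vectors beyond some \<open>N\<close>; so it suffices that a bound
  \<open>Re \<langle>S y, J y\<rangle> \<le> a \<parallel>y\<parallel>\<^sup>p\<close> at those vectors \<open>y\<close> implies \<open>Re (g S) \<le> a\<close> for every state \<open>g\<close>
  (\<open>calkin_state_le\<close>). A compact perturbation makes the bound hold at all vectors, and then Lumer's
  estimate \<open>\<parallel>1 + t S\<parallel> \<le> 1 + t a + O(t\<^sup>2)\<close> gives the claim, since \<open>1 + t Re (g S) \<le> \<parallel>1 + t S\<parallel>\<close>.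

  The condition \<open>p > 1\<close> enters above all through \<open>functional_small_on_tails\<close>: a bounded functional is
  small on vectors that live far out. Hence far vectors are weakly null, and mixed terms are negligible.
\<close>

section \<open>The spaces of p-summable sequences\<close>

lemma seq_add_apply [simp]: "seq_add x y j = x j + y j"
  by (simp add: seq_add_def)

lemma seq_scale_apply [simp]: "seq_scale c x j = c * x j"
  by (simp add: seq_scale_def)

lemma lp_norm_nonneg [simp]: "0 \<le> lp_norm p x"
  by (simp add: lp_norm_def)

lemma seq_diff_conv: "(\<lambda>j. x j - y j) = seq_add x (seq_scale (-1) y)"
  by (simp add: fun_eq_iff)

definition seq_head :: "nat \<Rightarrow> (nat \<Rightarrow> complex) \<Rightarrow> nat \<Rightarrow> complex" where
  "seq_head N x = (\<lambda>j. if j < N then x j else 0)"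

definition seq_tail :: "nat \<Rightarrow> (nat \<Rightarrow> complex) \<Rightarrow> nat \<Rightarrow> complex" where
  "seq_tail N x = (\<lambda>j. if j < N then 0 else x j)"

lemma head_add_tail: "seq_add (seq_head N x) (seq_tail N x) = x"
  by (auto simp: fun_eq_iff seq_head_def seq_tail_def)

definition block :: "nat \<Rightarrow> nat \<Rightarrow> (nat \<Rightarrow> complex) set" where
  "block M N = {x. \<forall>j. x j \<noteq> 0 \<longrightarrow> M \<le> j \<and> j < N}"

lemma block_scale: "x \<in> block M N \<Longrightarrow> seq_scale c x \<in> block M N"
  by (auto simp: block_def)

lemma block_add: "x \<in> block M N \<Longrightarrow> y \<in> block N N' \<Longrightarrow> M \<le> N \<Longrightarrow> N \<le> N' \<Longrightarrow> seq_add x y \<in> block M N'"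
  unfolding block_def mem_Collect_eq seq_add_apply
proof (intro allI impI)
  fix j assume *: "\<forall>j. x j \<noteq> 0 \<longrightarrow> M \<le> j \<and> j < N" "\<forall>j. y j \<noteq> 0 \<longrightarrow> N \<le> j \<and> j < N'"
    "M \<le> N" "N \<le> N'" "x j + y j \<noteq> 0"
  then have "x j \<noteq> 0 \<or> y j \<noteq> 0" by auto
  with * show "M \<le> j \<and> j < N'" by (meson le_trans less_le_trans)
qed

lemma head_tail_block: "seq_head N (seq_tail M x) \<in> block M N"
  by (auto simp: block_def seq_head_def seq_tail_def)

context
  fixes p :: real
  assumes p: "1 < p"
begin

lemma lp_norm_powr:
  assumes "x \<in> lp p"
  shows "lp_norm p x powr p = (\<Sum>j. cmod (x j) powr p)"
proof -
  have "(\<Sum>j. cmod (x j) powr p) \<ge> 0"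
    using assms by (intro suminf_nonneg) (auto simp: lp_def)
  then show ?thesis using p by (simp add: lp_norm_def powr_powr)
qed

lemma lp_norm_leI:
  assumes "\<And>n. (\<Sum>j<n. cmod (x j) powr p) \<le> C powr p" and "C \<ge> 0"
  shows "x \<in> lp p" and "lp_norm p x \<le> C"
proof -
  show x: "x \<in> lp p"
    unfolding lp_def mem_Collect_eq using assms by (intro summableI_nonneg_bounded) auto
  have "lp_norm p x powr p \<le> C powr p"
    unfolding lp_norm_powr[OF x] using assms x
    by (intro suminf_le_const) (auto simp: lp_def)
  then show "lp_norm p x \<le> C"
    using assms p by (smt (verit) lp_norm_nonneg powr_less_mono2)
qed

lemma sum_powr_le_lp_norm:
  assumes "x \<in> lp p" and "finite I"
  shows "(\<Sum>j\<in>I. cmod (x j) powr p) \<le> lp_norm p x powr p"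
  unfolding lp_norm_powr[OF assms(1)] using assms
  by (intro sum_le_suminf) (auto simp: lp_def)

lemma coordinate_le_lp_norm:
  assumes "x \<in> lp p"
  shows "cmod (x j) \<le> lp_norm p x"
proof -
  have "cmod (x j) powr p \<le> lp_norm p x powr p"
    using sum_powr_le_lp_norm[OF assms, of "{j}"] by simp
  then show ?thesis
    using p by (smt (verit) lp_norm_nonneg powr_less_mono2)
qed

lemma lp_norm_eq_0_iff:
  assumes "x \<in> lp p"
  shows "lp_norm p x = 0 \<longleftrightarrow> x = (\<lambda>j. 0)"
proof
  assume "lp_norm p x = 0"
  then show "x = (\<lambda>j. 0)" using coordinate_le_lp_norm[OF assms] by (intro ext) (metis norm_le_zero_iff)
qed (simp add: lp_norm_def)

lemma zero_in_lp [simp]: "(\<lambda>j. 0) \<in> lp p"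
  by (simp add: lp_def)

lemma lp_norm_zero [simp]: "lp_norm p (\<lambda>j. 0) = 0"
  by (simp add: lp_norm_def)

lemma powr_convex_combination:
  assumes "0 \<le> s" "0 \<le> t" "s + t = 1" "0 \<le> u" "0 \<le> v"
  shows "(s * u + t * v) powr p \<le> s * u powr p + t * v powr p"
proof -
  have shrink: "(r * w) powr p \<le> r * w powr p" if "0 \<le> r" "r \<le> 1" "0 \<le> w" for r w :: real
  proof -
    have "r powr p \<le> r"
      using that p powr_mono'[of 1 p r] by (cases "r = 0") auto
    then show ?thesis
      using that by (simp add: powr_mult mult_right_mono)
  qed
  show ?thesis
  proof (cases "u = 0 \<or> v = 0")
    case True
    then show ?thesis using assms shrink[of t v] shrink[of s u] by auto
  next
    case False
    then show ?thesis
      using convex_onD[OF powr_convex, of p t u v] assms p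
      by (smt (verit) greaterThan_iff real_scaleR_def)
  qed
qed

text \<open>Minkowski's inequality. For numbers \<open>a\<close> and \<open>b\<close> above the two norms, \<open>(x + y) / (a + b)\<close> is the
  convex combination of \<open>x / a\<close> and \<open>y / b\<close> with weights \<open>a / (a + b)\<close> and \<open>b / (a + b)\<close>, so that
  convexity of \<open>t \<mapsto> t\<^sup>p\<close> bounds the partial sums of the
  \<open>p\<close>-th powers of its coordinates by \<open>1\<close>.\<close>

lemma
  assumes x: "x \<in> lp p" and y: "y \<in> lp p"
  shows seq_add_in_lp: "seq_add x y \<in> lp p"
    and lp_norm_triangle: "lp_norm p (seq_add x y) \<le> lp_norm p x + lp_norm p y"
proof -
  have bound: "(\<Sum>j<n. cmod (seq_add x y j) powr p) \<le> (a + b) powr p"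
    if "lp_norm p x < a" "lp_norm p y < b" for a b n
  proof -
    have pos: "a > 0" "b > 0" using that lp_norm_nonneg[of p x] lp_norm_nonneg[of p y] by linarith+
    have "cmod (x j + y j) powr p
        \<le> (a + b) powr p * (a / (a + b) * (cmod (x j) powr p / a powr p)
                            + b / (a + b) * (cmod (y j) powr p / b powr p))" for j
    proof -
      have "cmod (x j + y j) powr p \<le> (cmod (x j) + cmod (y j)) powr p"
        using p by (intro powr_mono2 norm_triangle_ineq) auto
      also have "\<dots> = (a + b) powr p * (a / (a + b) * (cmod (x j) / a) + b / (a + b) * (cmod (y j) / b)) powr p"
        using pos by (simp add: powr_divide flip: add_divide_distrib)
      also have "\<dots> \<le> (a + b) powr p * (a / (a + b) * (cmod (x j) / a) powr p
                                            + b / (a + b) * (cmod (y j) / b) powr p)"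
        using pos by (intro mult_left_mono powr_convex_combination) (auto simp flip: add_divide_distrib)
      finally show ?thesis using pos by (simp add: powr_divide)
    qed
    then have "(\<Sum>j<n. cmod (seq_add x y j) powr p)
        \<le> (\<Sum>j<n. (a + b) powr p * (a / (a + b) * (cmod (x j) powr p / a powr p)
                            + b / (a + b) * (cmod (y j) powr p / b powr p)))"
      by (intro sum_mono) simp
    also have "\<dots> = (a + b) powr p * (a / (a + b) * ((\<Sum>j<n. cmod (x j) powr p) / a powr p)
                            + b / (a + b) * ((\<Sum>j<n. cmod (y j) powr p) / b powr p))"
      by (simp add: sum_distrib_left sum_divide_distrib sum.distrib distrib_left)
    also have "\<dots> \<le> (a + b) powr p * (a / (a + b) * 1 + b / (a + b) * 1)"
    proof -
      have "(\<Sum>j<n. cmod (x j) powr p) \<le> a powr p"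
        using sum_powr_le_lp_norm[OF x, of "{..<n}"] powr_mono2[of p "lp_norm p x" a] that p by auto
      moreover have "(\<Sum>j<n. cmod (y j) powr p) \<le> b powr p"
        using sum_powr_le_lp_norm[OF y, of "{..<n}"] powr_mono2[of p "lp_norm p y" b] that p by auto
      ultimately show ?thesis
        using pos by (intro mult_left_mono add_mono) auto
    qed
    also have "\<dots> = (a + b) powr p" using pos by (simp add: add_divide_distrib[symmetric])
    finally show ?thesis .
  qed
  have pos: "0 \<le> a + b" if "lp_norm p x < a" "lp_norm p y < b" for a b
    using that lp_norm_nonneg[of p x] lp_norm_nonneg[of p y] by linarith
  show "seq_add x y \<in> lp p"
    using bound[of "lp_norm p x + 1" "lp_norm p y + 1"] pos[of "lp_norm p x + 1" "lp_norm p y + 1"]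
    by (intro lp_norm_leI(1)) auto
  have less: "lp_norm p (seq_add x y) \<le> a + b" if "lp_norm p x < a" "lp_norm p y < b" for a b
    using bound[OF that] pos[OF that] by (rule lp_norm_leI(2))
  show "lp_norm p (seq_add x y) \<le> lp_norm p x + lp_norm p y"
  proof (rule field_le_epsilon)
    fix e :: real assume "e > 0"
    then show "lp_norm p (seq_add x y) \<le> lp_norm p x + lp_norm p y + e"
      using less[of "lp_norm p x + e/2" "lp_norm p y + e/2"] by simp
  qed
qed

lemma
  assumes x: "x \<in> lp p"
  shows seq_scale_in_lp: "seq_scale c x \<in> lp p"
    and lp_norm_scale: "lp_norm p (seq_scale c x) = cmod c * lp_norm p x"
proof -
  have s: "summable (\<lambda>j. cmod (x j) powr p)" using x by (simp add: lp_def)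
  then show "seq_scale c x \<in> lp p"
    by (auto simp: lp_def norm_mult powr_mult intro: summable_mult)
  have "(\<Sum>j. cmod (seq_scale c x j) powr p) = cmod c powr p * (\<Sum>j. cmod (x j) powr p)"
    using s by (simp add: norm_mult powr_mult suminf_mult)
  then show "lp_norm p (seq_scale c x) = cmod c * lp_norm p x"
    using p s by (simp add: lp_norm_def powr_mult powr_powr suminf_nonneg)
qed

lemma seq_diff_in_lp: "x \<in> lp p \<Longrightarrow> y \<in> lp p \<Longrightarrow> (\<lambda>j. x j - y j) \<in> lp p"
  by (simp add: seq_diff_conv seq_add_in_lp seq_scale_in_lp)

lemma lp_norm_mono:
  assumes "y \<in> lp p" and "\<And>j. cmod (x j) \<le> cmod (y j)"
  shows "x \<in> lp p" and "lp_norm p x \<le> lp_norm p y"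
proof -
  have "(\<Sum>j<n. cmod (x j) powr p) \<le> lp_norm p y powr p" for n
  proof -
    have "(\<Sum>j<n. cmod (x j) powr p) \<le> (\<Sum>j<n. cmod (y j) powr p)"
      using assms p by (intro sum_mono powr_mono2) auto
    also have "\<dots> \<le> lp_norm p y powr p" by (rule sum_powr_le_lp_norm) (use assms in auto)
    finally show ?thesis .
  qed
  from lp_norm_leI[OF this] show "x \<in> lp p" and "lp_norm p x \<le> lp_norm p y" by auto
qed

lemma Metric_space_lp: "Metric_space (lp p) (\<lambda>x y. lp_norm p (\<lambda>j. x j - y j))"
proof
  fix x y z :: "nat \<Rightarrow> complex"
  show "lp_norm p (\<lambda>j. x j - y j) = lp_norm p (\<lambda>j. y j - x j)"
    by (simp add: lp_norm_def norm_minus_commute)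
  show "(lp_norm p (\<lambda>j. x j - y j) = 0) = (x = y)" if "x \<in> lp p" "y \<in> lp p"
    using lp_norm_eq_0_iff[OF seq_diff_in_lp[OF that]] by (auto simp: fun_eq_iff)
  show "lp_norm p (\<lambda>j. x j - z j) \<le> lp_norm p (\<lambda>j. x j - y j) + lp_norm p (\<lambda>j. y j - z j)"
    if "x \<in> lp p" "y \<in> lp p" "z \<in> lp p"
    using lp_norm_triangle[OF seq_diff_in_lp[OF that(1,2)] seq_diff_in_lp[OF that(2,3)]]
    by (simp add: seq_add_def)
qed simp

lemma lp_norm_disjoint_add:
  assumes "x \<in> lp p" "y \<in> lp p" and disj: "\<And>j. x j = 0 \<or> y j = 0"
  shows "lp_norm p (seq_add x y) powr p = lp_norm p x powr p + lp_norm p y powr p"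
proof -
  have "cmod (x j + y j) powr p = cmod (x j) powr p + cmod (y j) powr p" for j
    using disj[of j] by auto
  then show ?thesis
    using suminf_add[of "\<lambda>j. cmod (x j) powr p" "\<lambda>j. cmod (y j) powr p"] assms(1,2)
    by (simp add: lp_norm_powr[OF assms(1)] lp_norm_powr[OF assms(2)] lp_norm_powr[OF seq_add_in_lp[OF assms(1,2)]])
      (simp add: lp_def)
qed

lemma cmod_duality_map: "cmod (duality_map p x j) = cmod (x j) powr (p - 1)"
proof (cases "x j = 0")
  case False
  then show ?thesis
    using powr_add[of "cmod (x j)" 1 "p - 2"] by (simp add: duality_map_def norm_mult)
qed (simp add: duality_map_def)

lemma Young_powr:
  assumes "0 \<le> u" "0 \<le> v"
  shows "u * v powr (p - 1) \<le> u powr p / p + (1 - 1 / p) * v powr p"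
proof (cases "u = 0 \<or> v = 0")
  case False
  then show ?thesis
    using Youngs_inequality_0[of "1/p" "1 - 1/p" "u powr p" "v powr p"] assms p
    by (simp add: powr_powr right_diff_distrib)
qed (use assms p in auto)

text \<open>Hoelder's inequality for the pairing with \<open>duality_map p x\<close>: the \<open>q\<close>-norm of that sequence is
  the power \<open>p - 1\<close> of the norm of \<open>x\<close>. It comes from Young's inequality in each coordinate, after
  normalising both vectors.\<close>

lemma Hoelder_duality_map:
  assumes u: "u \<in> lp p" and x: "x \<in> lp p"
  shows summable_pairing_cmod: "summable (\<lambda>j. cmod (u j * cnj (duality_map p x j)))"
    and suminf_pairing_cmod_le:
      "(\<Sum>j. cmod (u j * cnj (duality_map p x j))) \<le> lp_norm p u * lp_norm p x powr (p - 1)"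
proof -
  have su: "summable (\<lambda>j. cmod (u j) powr p)" and sx: "summable (\<lambda>j. cmod (x j) powr p)"
    using u x by (auto simp: lp_def)
  have eq: "cmod (u j * cnj (duality_map p x j)) = cmod (u j) * cmod (x j) powr (p - 1)" for j
    by (simp add: norm_mult cmod_duality_map)
  show s: "summable (\<lambda>j. cmod (u j * cnj (duality_map p x j)))"
    unfolding eq
  proof (rule summable_comparison_test'[where N=0])
    show "summable (\<lambda>j. cmod (u j) powr p / p + (1 - 1/p) * cmod (x j) powr p)"
      using su sx by (intro summable_add summable_divide summable_mult)
  qed (simp add: Young_powr)
  show "(\<Sum>j. cmod (u j * cnj (duality_map p x j))) \<le> lp_norm p u * lp_norm p x powr (p - 1)"
  proof (cases "lp_norm p u = 0 \<or> lp_norm p x = 0")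
    case True
    then have "u = (\<lambda>j. 0) \<or> x = (\<lambda>j. 0)" using u x lp_norm_eq_0_iff by blast
    then show ?thesis by (auto simp: duality_map_def)
  next
    case False
    define a b where "a = lp_norm p u" and "b = lp_norm p x"
    then have pos: "a > 0" "b > 0"
      using False lp_norm_nonneg[of p u] lp_norm_nonneg[of p x] by (auto simp: less_le)
    have le: "cmod (u j) * cmod (x j) powr (p - 1)
       \<le> a * b powr (p - 1) * (cmod (u j) powr p / (a powr p * p) + (1 - 1/p) * (cmod (x j) powr p / b powr p))" for j
    proof -
      have "cmod (u j) * cmod (x j) powr (p - 1)
          = a * b powr (p - 1) * ((cmod (u j) / a) * (cmod (x j) / b) powr (p - 1))"
        using pos by (simp add: powr_divide)
      also have "\<dots> \<le> a * b powr (p - 1) * ((cmod (u j) / a) powr p / p + (1 - 1/p) * (cmod (x j) / b) powr p)"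
        using pos by (intro mult_left_mono Young_powr) auto
      finally show ?thesis using pos by (simp add: powr_divide)
    qed
    have "(\<lambda>j. a * b powr (p - 1) * (cmod (u j) powr p / (a powr p * p) + (1 - 1/p) * (cmod (x j) powr p / b powr p)))
       sums (a * b powr (p - 1) * (lp_norm p u powr p / (a powr p * p) + (1 - 1/p) * (lp_norm p x powr p / b powr p)))"
      (is "?f sums _")
      unfolding lp_norm_powr[OF u] lp_norm_powr[OF x] using su sx
      by (intro sums_mult sums_add sums_divide summable_sums)
    then have f: "?f sums (a * b powr (p - 1))"
      using pos p by (simp flip: a_def b_def)
    have "(\<lambda>j. cmod (u j) * cmod (x j) powr (p - 1)) sums (\<Sum>j. cmod (u j * cnj (duality_map p x j)))"
      using summable_sums[OF s] by (simp only: eq)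
    with le have "(\<Sum>j. cmod (u j * cnj (duality_map p x j))) \<le> a * b powr (p - 1)"
      using f by (rule sums_le)
    then show ?thesis by (simp only: a_def b_def)
  qed
qed

lemma summable_pairing:
  "u \<in> lp p \<Longrightarrow> x \<in> lp p \<Longrightarrow> summable (\<lambda>j. u j * cnj (duality_map p x j))"
  by (rule summable_norm_cancel[OF summable_pairing_cmod])

lemma cmod_pairing_le:
  assumes "u \<in> lp p" "x \<in> lp p"
  shows "cmod (seq_pairing u (duality_map p x)) \<le> lp_norm p u * lp_norm p x powr (p - 1)"
  unfolding seq_pairing_def
  using summable_norm[OF summable_pairing_cmod[OF assms]] suminf_pairing_cmod_le[OF assms] by linarith

lemma pairing_add:
  assumes "u \<in> lp p" "v \<in> lp p" "x \<in> lp p"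
  shows "seq_pairing (seq_add u v) (duality_map p x)
    = seq_pairing u (duality_map p x) + seq_pairing v (duality_map p x)"
  using suminf_add[OF summable_pairing summable_pairing, OF assms(1,3) assms(2,3)]
  by (simp add: seq_pairing_def distrib_right)

lemma pairing_scale:
  assumes "u \<in> lp p" "x \<in> lp p"
  shows "seq_pairing (seq_scale c u) (duality_map p x) = c * seq_pairing u (duality_map p x)"
  using suminf_mult[OF summable_pairing[OF assms]] by (simp add: seq_pairing_def mult.assoc)

lemma pairing_self:
  assumes "x \<in> lp p"
  shows "seq_pairing x (duality_map p x) = of_real (lp_norm p x powr p)"
proof -
  have "x j * cnj (duality_map p x j) = of_real (cmod (x j) powr p)" for j
  proof (cases "x j = 0")
    case False
    have "x j * cnj (duality_map p x j) = x j * cnj (x j) * of_real (cmod (x j) powr (p - 2))"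
      by (simp add: duality_map_def)
    also have "\<dots> = of_real ((cmod (x j))\<^sup>2 * cmod (x j) powr (p - 2))"
      by (simp only: complex_norm_square of_real_mult)
    also have "(cmod (x j))\<^sup>2 * cmod (x j) powr (p - 2) = cmod (x j) powr p"
      using False by (simp add: powr_diff power2_eq_square)
    finally show ?thesis .
  qed simp
  then show ?thesis
    using assms by (simp add: seq_pairing_def lp_norm_powr[OF assms] lp_def suminf_of_real)
qed

lemma head_tail_in_lp:
  assumes "x \<in> lp p"
  shows "seq_head N x \<in> lp p" "seq_tail N x \<in> lp p"
    "lp_norm p (seq_head N x) \<le> lp_norm p x" "lp_norm p (seq_tail N x) \<le> lp_norm p x"
  using lp_norm_mono[OF assms, of "seq_head N x"] lp_norm_mono[OF assms, of "seq_tail N x"]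
  by (auto simp: seq_head_def seq_tail_def)

lemma lp_norm_tail_tendsto_0:
  assumes "x \<in> lp p"
  shows "(\<lambda>N. lp_norm p (seq_tail N x)) \<longlonglongrightarrow> 0"
proof -
  have s: "summable (\<lambda>j. cmod (x j) powr p)" using assms by (simp add: lp_def)
  have "(\<Sum>j. cmod (seq_tail N x j) powr p) = (\<Sum>j. cmod (x j) powr p) - (\<Sum>j<N. cmod (x j) powr p)" for N
  proof -
    have "cmod (x j) powr p = cmod (seq_head N x j) powr p + cmod (seq_tail N x j) powr p" for j
      using p by (simp add: seq_head_def seq_tail_def)
    then have "(\<Sum>j. cmod (x j) powr p) = (\<Sum>j. cmod (seq_head N x j) powr p) + (\<Sum>j. cmod (seq_tail N x j) powr p)"
      using head_tail_in_lp[OF assms, of N] by (simp add: suminf_add lp_def)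
    moreover have "(\<Sum>j. cmod (seq_head N x j) powr p) = (\<Sum>j<N. cmod (x j) powr p)"
      by (subst suminf_finite[of "{..<N}"]) (auto simp: seq_head_def)
    ultimately show ?thesis by simp
  qed
  then have "(\<lambda>N. \<Sum>j. cmod (seq_tail N x j) powr p) \<longlonglongrightarrow> 0"
    using tendsto_diff[OF tendsto_const summable_LIMSEQ[OF s], of "\<Sum>j. cmod (x j) powr p"] by simp
  then have "(\<lambda>N. (\<Sum>j. cmod (seq_tail N x j) powr p) powr (1/p)) \<longlonglongrightarrow> 0 powr (1/p)"
    using p head_tail_in_lp[OF assms]
    by (intro tendsto_powr') (auto intro!: always_eventually suminf_nonneg simp: lp_def)
  then show ?thesis by (simp add: lp_norm_def)
qed

lemma block_in_lp: "x \<in> block M N \<Longrightarrow> x \<in> lp p"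
  by (auto simp: lp_def block_def intro!: summable_finite[of "{..<N}"])

lemma lp_norm_scale_block: "x \<in> block M N \<Longrightarrow> lp_norm p (seq_scale c x) = cmod c * lp_norm p x"
  by (rule lp_norm_scale[OF block_in_lp])

text \<open>A bounded functional is small on vectors that live far out. Otherwise there are \<open>n\<close> successive
  blocks on which it takes the value \<open>\<epsilon>\<close> at least; on their sum it takes the value \<open>n \<epsilon>\<close> while the
  norm is only \<open>n\<^sup>1\<^sup>/\<^sup>p\<close>, which contradicts \<open>p > 1\<close> for large \<open>n\<close>.\<close>

lemma functional_small_on_tails:
  assumes \<phi>: "\<phi> \<in> dual_space (lp p) seq_add seq_scale (lp_norm p)" and \<epsilon>: "0 < \<epsilon>"
  obtains M where "\<And>N y. y \<in> block M N \<Longrightarrow> lp_norm p y \<le> 1 \<Longrightarrow> cmod (\<phi> y) \<le> \<epsilon>"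
proof (rule ccontr)
  assume "\<not> thesis"
  then have far: "\<exists>N y. y \<in> block M N \<and> lp_norm p y \<le> 1 \<and> \<epsilon> < cmod (\<phi> y)" for M
    using that by (meson not_le)
  from \<phi> obtain C where
    add: "\<And>x y. x \<in> lp p \<Longrightarrow> y \<in> lp p \<Longrightarrow> \<phi> (seq_add x y) = \<phi> x + \<phi> y" and
    scale: "\<And>c x. x \<in> lp p \<Longrightarrow> \<phi> (seq_scale c x) = c * \<phi> x" and
    C: "\<And>x. x \<in> lp p \<Longrightarrow> cmod (\<phi> x) \<le> C * lp_norm p x"
    unfolding dual_space_def by blast
  have sums: "\<exists>N z. z \<in> block 0 N \<and> lp_norm p z powr p \<le> n \<and> n * \<epsilon> \<le> Re (\<phi> z)" for n :: nat
  proof (induction n)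
    case 0
    have "\<phi> (\<lambda>j. 0) = 0" using C[of "\<lambda>j. 0"] by simp
    then show ?case by (intro exI[of _ 0] exI[of _ "\<lambda>j. 0"]) (simp add: block_def)
  next
    case (Suc n)
    then obtain N z where z: "z \<in> block 0 N" "lp_norm p z powr p \<le> n" "n * \<epsilon> \<le> Re (\<phi> z)" by blast
    obtain N' y where y: "y \<in> block N N'" "lp_norm p y \<le> 1" "\<epsilon> < cmod (\<phi> y)" using far by blast
    then have nz: "\<phi> y \<noteq> 0" using \<epsilon> by auto
    have "y \<in> block N (max N N')" using y by (auto simp: block_def)
    \<comment> \<open>The phase that makes the value of the functional positive, so that values add up.\<close>
    define c where "c = cnj (\<phi> y) / cmod (\<phi> y)"
    let ?y = "seq_scale c y"
    have c: "cmod c = 1" "c * \<phi> y = cmod (\<phi> y)"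
      using nz by (simp_all add: c_def norm_divide complex_norm_square[symmetric] power2_eq_square
          mult.commute[of "cnj _"])
    have zl: "z \<in> lp p" and yl: "y \<in> lp p" "?y \<in> lp p" using z y block_in_lp seq_scale_in_lp by blast+
    have "seq_add z ?y \<in> block 0 (max N N')"
      using z(1) \<open>y \<in> block N (max N N')\<close> by (intro block_add[of _ _ N] block_scale) auto
    moreover have "lp_norm p (seq_add z ?y) powr p \<le> Suc n"
    proof -
      have "z j = 0 \<or> ?y j = 0" for j
        using z(1) y(1) unfolding block_def by (cases "j < N") auto
      then have "lp_norm p (seq_add z ?y) powr p = lp_norm p z powr p + lp_norm p y powr p"
        using lp_norm_disjoint_add[OF zl yl(2)] c yl by (simp add: lp_norm_scale)
      moreover have "lp_norm p y powr p \<le> 1"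
        using y(2) p by (simp add: powr_le1)
      ultimately show ?thesis using z(2) by simp
    qed
    moreover have "Suc n * \<epsilon> \<le> Re (\<phi> (seq_add z ?y))"
      using z(3) y(3) c by (simp add: add[OF zl yl(2)] scale[OF yl(1)] distrib_right)
    ultimately show ?case by blast
  qed
  have bound: "n powr (1 - 1/p) * \<epsilon> \<le> max C 0" if "n > 0" for n :: nat
  proof -
    obtain N z where z: "z \<in> block 0 N" "lp_norm p z powr p \<le> n" "n * \<epsilon> \<le> Re (\<phi> z)" using sums by blast
    have "(lp_norm p z powr p) powr (1/p) \<le> n powr (1/p)" using z(2) p by (intro powr_mono2) auto
    then have "lp_norm p z \<le> n powr (1/p)" using p by (simp add: powr_powr)
    have "n powr 1 * \<epsilon> \<le> C * lp_norm p z"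
      using z(3) C[OF block_in_lp[OF z(1)]] complex_Re_le_cmod[of "\<phi> z"] by simp
    also have "\<dots> \<le> max C 0 * n powr (1/p)"
      using \<open>lp_norm p z \<le> n powr (1/p)\<close> by (intro mult_mono) auto
    finally show ?thesis using that by (simp add: powr_diff field_simps)
  qed
  have "filterlim (\<lambda>n. real n powr (1 - 1/p) * \<epsilon>) at_top sequentially"
    using p \<epsilon> by real_asymp
  then have "\<forall>\<^sub>F n in sequentially. max C 0 < real n powr (1 - 1/p) * \<epsilon>"
    unfolding filterlim_at_top_dense by blast
  then have "\<forall>\<^sub>F n in sequentially. False"
    using eventually_gt_at_top[of "0::nat"] by eventually_elim (metis bound not_le)
  then show False by simp
qed

lemma weakly_null_of_escaping_support:
  assumes "\<And>n. \<exists>N. x n \<in> block n N" and "\<And>n. lp_norm p (x n) \<le> 1"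
  shows "lp_weakly_null p x"
  unfolding lp_weakly_null_def
proof (intro ballI LIMSEQ_I)
  fix \<phi> and \<epsilon> :: real
  assume \<phi>: "\<phi> \<in> dual_space (lp p) seq_add seq_scale (lp_norm p)" and "0 < \<epsilon>"
  then obtain M where M: "\<And>N y. y \<in> block M N \<Longrightarrow> lp_norm p y \<le> 1 \<Longrightarrow> cmod (\<phi> y) \<le> \<epsilon> / 2"
    using functional_small_on_tails[OF \<phi>, of "\<epsilon>/2"] by (metis half_gt_zero)
  have "cmod (\<phi> (x n) - 0) < \<epsilon>" if n: "M \<le> n" for n
  proof -
    obtain N where "x n \<in> block n N" using assms by blast
    then have "x n \<in> block M N" using n by (auto simp: block_def)
    then show ?thesis using M assms(2) \<open>0 < \<epsilon>\<close> by (smt (verit) diff_zero field_sum_of_halves)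
  qed
  then show "\<exists>no. \<forall>n\<ge>no. norm (\<phi> (x n) - 0) < \<epsilon>" by blast
qed

end

section \<open>Bounded operators\<close>

abbreviation lp_op_norm :: "real \<Rightarrow> ((nat \<Rightarrow> complex) \<Rightarrow> (nat \<Rightarrow> complex)) \<Rightarrow> real" where
  "lp_op_norm p \<equiv> alg_norm (lp_operator_algebra p)"

lemma
  assumes "T \<in> lp_operators p" and "x \<in> lp p"
  shows lp_operator_in_lp: "T x \<in> lp p"
    and lp_operator_add: "y \<in> lp p \<Longrightarrow> T (seq_add x y) = seq_add (T x) (T y)"
    and lp_operator_scale: "T (seq_scale c x) = seq_scale c (T x)"
  using assms by (auto simp: lp_operators_def PiE_def Pi_def)

lemma lp_operatorsI:
  assumes "T \<in> extensional (lp p)" and "\<And>x. x \<in> lp p \<Longrightarrow> T x \<in> lp p"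
    and "\<And>x y. x \<in> lp p \<Longrightarrow> y \<in> lp p \<Longrightarrow> T (seq_add x y) = seq_add (T x) (T y)"
    and "\<And>c x. x \<in> lp p \<Longrightarrow> T (seq_scale c x) = seq_scale c (T x)"
    and "\<And>x. x \<in> lp p \<Longrightarrow> lp_norm p (T x) \<le> C * lp_norm p x"
  shows "T \<in> lp_operators p"
  unfolding lp_operators_def using assms by (auto simp: PiE_def intro!: exI[of _ C])

lemma lp_operators_eqI:
  assumes "S \<in> lp_operators p" "T \<in> lp_operators p" "\<And>x j. x \<in> lp p \<Longrightarrow> S x j = T x j"
  shows "S = T"
proof (rule extensionalityI)
  show "S \<in> extensional (lp p)" "T \<in> extensional (lp p)"
    using assms(1,2) by (auto simp: lp_operators_def PiE_def)
qed (use assms(3) in auto)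

lemma lp_operator_algebra_simps [simp]:
  "carrier (lp_operator_algebra p) = lp_operators p"
  "x \<in> lp p \<Longrightarrow> (S \<oplus>\<^bsub>lp_operator_algebra p\<^esub> T) x = seq_add (S x) (T x)"
  "x \<in> lp p \<Longrightarrow> (c \<odot>\<^bsub>lp_operator_algebra p\<^esub> T) x = seq_scale c (T x)"
  "x \<in> lp p \<Longrightarrow> (S \<otimes>\<^bsub>lp_operator_algebra p\<^esub> T) x = S (T x)"
  "x \<in> lp p \<Longrightarrow> \<one>\<^bsub>lp_operator_algebra p\<^esub> x = x"
  "x \<in> lp p \<Longrightarrow> \<zero>\<^bsub>lp_operator_algebra p\<^esub> x = (\<lambda>j. 0)"
  by (simp_all add: lp_operator_algebra_def compose_def)

lemma seq_head_add: "seq_head N (seq_add x y) = seq_add (seq_head N x) (seq_head N y)"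
  by (simp add: seq_head_def fun_eq_iff)

lemma seq_head_scale: "seq_head N (seq_scale c x) = seq_scale c (seq_head N x)"
  by (simp add: seq_head_def fun_eq_iff)

text \<open>The coordinate projection as an element of \<open>lp_operators p\<close>, whose members are \<open>undefined\<close> outside
  \<open>lp p\<close>.\<close>

definition head_operator :: "real \<Rightarrow> nat \<Rightarrow> (nat \<Rightarrow> complex) \<Rightarrow> nat \<Rightarrow> complex" where
  "head_operator p N = (\<lambda>x\<in>lp p. seq_head N x)"

lemma head_operator_apply [simp]: "x \<in> lp p \<Longrightarrow> head_operator p N x = seq_head N x"
  by (simp add: head_operator_def)

context
  fixes p :: real
  assumes p: "1 < p"
begin

lemma
  assumes T: "T \<in> lp_operators p"
  shows lp_op_norm_upper: "x \<in> lp p \<Longrightarrow> lp_norm p x \<le> 1 \<Longrightarrow> lp_norm p (T x) \<le> lp_op_norm p T"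
    and lp_op_norm_nonneg: "0 \<le> lp_op_norm p T"
    and lp_op_norm_bound: "x \<in> lp p \<Longrightarrow> lp_norm p (T x) \<le> lp_op_norm p T * lp_norm p x"
proof -
  obtain C where C: "\<And>x. x \<in> lp p \<Longrightarrow> lp_norm p (T x) \<le> C * lp_norm p x"
    using T unfolding lp_operators_def by blast
  have "bdd_above ((\<lambda>x. lp_norm p (T x)) ` {x \<in> lp p. lp_norm p x \<le> 1})"
  proof (rule bdd_aboveI2)
    fix x assume x: "x \<in> {x \<in> lp p. lp_norm p x \<le> 1}"
    then have "lp_norm p (T x) \<le> C * lp_norm p x" using C by auto
    also have "\<dots> \<le> \<bar>C\<bar> * 1" using x by (intro mult_mono) auto
    finally show "lp_norm p (T x) \<le> \<bar>C\<bar>" by simp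
  qed
  then show upper: "lp_norm p (T x) \<le> lp_op_norm p T" if "x \<in> lp p" "lp_norm p x \<le> 1" for x
    using that cSUP_upper[of x "{x \<in> lp p. lp_norm p x \<le> 1}" "\<lambda>x. lp_norm p (T x)"]
    by (simp add: lp_operator_algebra_def)
  show nonneg: "0 \<le> lp_op_norm p T"
    using upper[OF zero_in_lp[OF p]] lp_norm_zero[OF p] order_trans[OF lp_norm_nonneg] by fastforce
  show "lp_norm p (T x) \<le> lp_op_norm p T * lp_norm p x" if x: "x \<in> lp p"
  proof (cases "lp_norm p x = 0")
    case True
    then show ?thesis using C[OF x] by simp
  next
    case False
    then have pos: "lp_norm p x > 0" using lp_norm_nonneg[of p x] by linarith
    let ?c = "complex_of_real (1 / lp_norm p x)"
    have "lp_norm p (T (seq_scale ?c x)) \<le> lp_op_norm p T"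
      using pos by (intro upper seq_scale_in_lp[OF p x]) (simp add: lp_norm_scale[OF p x] norm_divide)
    moreover have "lp_norm p (T (seq_scale ?c x)) = lp_norm p (T x) / lp_norm p x"
      using pos by (simp add: lp_operator_scale[OF T x] lp_norm_scale[OF p lp_operator_in_lp[OF T x]] norm_divide)
    ultimately have "lp_norm p (T x) / lp_norm p x \<le> lp_op_norm p T" by (simp only:)
    then show ?thesis using pos by (simp only: pos_divide_le_eq)
  qed
qed

lemma lp_op_norm_least:
  assumes "\<And>x. x \<in> lp p \<Longrightarrow> lp_norm p x \<le> 1 \<Longrightarrow> lp_norm p (T x) \<le> C"
  shows "lp_op_norm p T \<le> C"
proof -
  have "{x \<in> lp p. lp_norm p x \<le> 1} \<noteq> {}" using zero_in_lp[OF p] lp_norm_zero[OF p] by force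
  then show ?thesis
    using assms by (simp add: lp_operator_algebra_def) (rule cSUP_least; auto)
qed

lemma lp_operator_diff:
  assumes "T \<in> lp_operators p" "x \<in> lp p" "y \<in> lp p"
  shows "T (\<lambda>j. x j - y j) = (\<lambda>j. T x j - T y j)"
  using assms by (simp only: seq_diff_conv lp_operator_add lp_operator_scale seq_scale_in_lp[OF p])

lemma add_operator_closed [intro]:
  assumes S: "S \<in> lp_operators p" and T: "T \<in> lp_operators p"
  shows "S \<oplus>\<^bsub>lp_operator_algebra p\<^esub> T \<in> lp_operators p"
proof (rule lp_operatorsI[where C = "lp_op_norm p S + lp_op_norm p T"])
  fix x assume x: "x \<in> lp p"
  note Sx = lp_operator_in_lp[OF S x] and Tx = lp_operator_in_lp[OF T x]
  show "(S \<oplus>\<^bsub>lp_operator_algebra p\<^esub> T) x \<in> lp p"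
    using Sx Tx x by (simp add: seq_add_in_lp[OF p])
  show "lp_norm p ((S \<oplus>\<^bsub>lp_operator_algebra p\<^esub> T) x) \<le> (lp_op_norm p S + lp_op_norm p T) * lp_norm p x"
    using lp_norm_triangle[OF p Sx Tx] lp_op_norm_bound[OF S x] lp_op_norm_bound[OF T x] x
    by (simp add: distrib_right)
qed (use S T in \<open>auto simp: lp_operator_algebra_def seq_add_in_lp[OF p] seq_scale_in_lp[OF p] lp_operator_add
      lp_operator_scale fun_eq_iff distrib_left\<close>)

lemma scale_operator_closed [intro]:
  assumes T: "T \<in> lp_operators p"
  shows "c \<odot>\<^bsub>lp_operator_algebra p\<^esub> T \<in> lp_operators p"
proof (rule lp_operatorsI[where C = "cmod c * lp_op_norm p T"])
  fix x assume x: "x \<in> lp p"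
  note Tx = lp_operator_in_lp[OF T x]
  show "(c \<odot>\<^bsub>lp_operator_algebra p\<^esub> T) x \<in> lp p"
    using Tx x by (simp add: seq_scale_in_lp[OF p])
  show "lp_norm p ((c \<odot>\<^bsub>lp_operator_algebra p\<^esub> T) x) \<le> cmod c * lp_op_norm p T * lp_norm p x"
    using lp_op_norm_bound[OF T x] x by (simp add: lp_norm_scale[OF p Tx] mult.assoc mult_left_mono)
qed (use T in \<open>auto simp: lp_operator_algebra_def seq_add_in_lp[OF p] seq_scale_in_lp[OF p] lp_operator_add
      lp_operator_scale fun_eq_iff distrib_left\<close>)

lemma mult_operator_closed [intro]:
  assumes S: "S \<in> lp_operators p" and T: "T \<in> lp_operators p"
  shows "S \<otimes>\<^bsub>lp_operator_algebra p\<^esub> T \<in> lp_operators p"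
proof (rule lp_operatorsI[where C = "lp_op_norm p S * lp_op_norm p T"])
  fix x assume x: "x \<in> lp p"
  note Tx = lp_operator_in_lp[OF T x]
  show "lp_norm p ((S \<otimes>\<^bsub>lp_operator_algebra p\<^esub> T) x) \<le> lp_op_norm p S * lp_op_norm p T * lp_norm p x"
    using lp_op_norm_bound[OF S Tx] mult_left_mono[OF lp_op_norm_bound[OF T x] lp_op_norm_nonneg[OF S]] x
    by (simp add: mult.assoc)
  show "(S \<otimes>\<^bsub>lp_operator_algebra p\<^esub> T) (seq_add x y)
      = seq_add ((S \<otimes>\<^bsub>lp_operator_algebra p\<^esub> T) x) ((S \<otimes>\<^bsub>lp_operator_algebra p\<^esub> T) y)" if "y \<in> lp p" for y
    using x that lp_operator_add[OF S lp_operator_in_lp[OF T x] lp_operator_in_lp[OF T that]]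
    by (simp add: seq_add_in_lp[OF p] lp_operator_add[OF T] fun_eq_iff)
  show "(S \<otimes>\<^bsub>lp_operator_algebra p\<^esub> T) (seq_scale c x)
      = seq_scale c ((S \<otimes>\<^bsub>lp_operator_algebra p\<^esub> T) x)" for c
    using x lp_operator_scale[OF S lp_operator_in_lp[OF T x]]
    by (simp add: seq_scale_in_lp[OF p] lp_operator_scale[OF T] fun_eq_iff)
  show "(S \<otimes>\<^bsub>lp_operator_algebra p\<^esub> T) x \<in> lp p"
    using S T x by (simp add: lp_operator_in_lp)
qed (simp add: lp_operator_algebra_def compose_def)

lemma one_operator_closed [intro]: "\<one>\<^bsub>lp_operator_algebra p\<^esub> \<in> lp_operators p"
  by (rule lp_operatorsI[where C = 1])
    (auto simp: lp_operator_algebra_def seq_add_in_lp[OF p] seq_scale_in_lp[OF p])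

lemma zero_operator_closed [intro]: "\<zero>\<^bsub>lp_operator_algebra p\<^esub> \<in> lp_operators p"
  by (rule lp_operatorsI[where C = 0])
    (auto simp: lp_operator_algebra_def zero_in_lp[OF p] lp_norm_zero[OF p] seq_add_in_lp[OF p]
      seq_scale_in_lp[OF p] fun_eq_iff)

lemma head_operator_closed [intro]: "head_operator p N \<in> lp_operators p"
  by (rule lp_operatorsI[where C = 1])
    (auto simp: head_operator_def seq_add_in_lp[OF p] seq_scale_in_lp[OF p] head_tail_in_lp[OF p]
      seq_head_add seq_head_scale)

lemma abelian_group_lp_operators: "abelian_group (lp_operator_algebra p)"
proof (rule abelian_groupI; unfold lp_operator_algebra_simps(1))
  show "\<exists>S\<in>lp_operators p. S \<oplus>\<^bsub>lp_operator_algebra p\<^esub> T = \<zero>\<^bsub>lp_operator_algebra p\<^esub>"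
    if "T \<in> lp_operators p" for T
    using that
    by (intro bexI[of _ "(-1) \<odot>\<^bsub>lp_operator_algebra p\<^esub> T"] lp_operators_eqI[of _ p]) auto
qed (auto intro!: lp_operators_eqI[of _ p])

lemma minus_operator_eq:
  assumes "T \<in> lp_operators p"
  shows "\<ominus>\<^bsub>lp_operator_algebra p\<^esub> T = (-1) \<odot>\<^bsub>lp_operator_algebra p\<^esub> T"
  using assms
  by (intro abelian_group.minus_equality[OF abelian_group_lp_operators] lp_operators_eqI[of _ p]) auto

text \<open>Weakly null sequences are tested with two kinds of functionals: the coordinates of \<open>T x\<close> identify
  norm limits of the images under a compact operator, and the pairings with a fixed vector are the
  mixed terms in the convexity argument.\<close>

lemma coordinate_functional:
  assumes T: "T \<in> lp_operators p"
  shows "(\<lambda>x. T x j) \<in> dual_space (lp p) seq_add seq_scale (lp_norm p)"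
  unfolding dual_space_def
proof (intro CollectI conjI exI[of _ "lp_op_norm p T"] ballI allI)
  fix x assume x: "x \<in> lp p"
  show "cmod (T x j) \<le> lp_op_norm p T * lp_norm p x"
    using coordinate_le_lp_norm[OF p lp_operator_in_lp[OF T x], of j] lp_op_norm_bound[OF T x] by linarith
qed (simp_all add: lp_operator_add[OF T] lp_operator_scale[OF T])

lemma pairing_functional:
  assumes T: "T \<in> lp_operators p" and y: "y \<in> lp p"
  shows "(\<lambda>x. seq_pairing (T x) (duality_map p y)) \<in> dual_space (lp p) seq_add seq_scale (lp_norm p)"
  unfolding dual_space_def
proof (intro CollectI conjI exI[of _ "lp_op_norm p T * lp_norm p y powr (p - 1)"] ballI allI)
  fix x assume x: "x \<in> lp p"
  have "cmod (seq_pairing (T x) (duality_map p y)) \<le> lp_norm p (T x) * lp_norm p y powr (p - 1)"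
    by (rule cmod_pairing_le[OF p lp_operator_in_lp[OF T x] y])
  also have "\<dots> \<le> (lp_op_norm p T * lp_norm p x) * lp_norm p y powr (p - 1)"
    by (intro mult_right_mono lp_op_norm_bound[OF T x]) simp
  finally show "cmod (seq_pairing (T x) (duality_map p y)) \<le> lp_op_norm p T * lp_norm p y powr (p - 1) * lp_norm p x"
    by (simp add: mult_ac)
qed (simp_all add: lp_operator_add[OF T] lp_operator_scale[OF T] pairing_add[OF p] pairing_scale[OF p]
    lp_operator_in_lp[OF T] y)

lemma pairing_operator_bound:
  assumes T: "T \<in> lp_operators p" and x: "x \<in> lp p" "lp_norm p x = 1"
  shows "cmod (seq_pairing (T x) (duality_map p x)) \<le> lp_op_norm p T"
  using cmod_pairing_le[OF p lp_operator_in_lp[OF T x(1)] x(1)] lp_op_norm_bound[OF T x(1)] x(2) by simp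

section \<open>Compact operators\<close>

text \<open>The definition speaks of the closure of the image of the unit ball, the criterion only of the image.
  A sequence in the closure is therefore shadowed by images \<open>K (s n)\<close> at distance less than
  \<open>1 / (n + 1)\<close>, and it converges along every subsequence along which the images converge.\<close>

lemma compact_operator_iff:
  "K \<in> lp_compact_operators p \<longleftrightarrow> K \<in> lp_operators p \<and>
    (\<forall>s::nat \<Rightarrow> nat \<Rightarrow> complex. (\<forall>n. s n \<in> lp p \<and> lp_norm p (s n) \<le> 1) \<longrightarrow>
      (\<exists>l r. strict_mono r \<and> l \<in> lp p \<and> (\<lambda>n. lp_norm p (\<lambda>j. K (s (r n)) j - l j)) \<longlonglongrightarrow> 0))"
  (is "_ \<longleftrightarrow> _ \<and> ?seq")
proof -
  interpret M: Metric_space "lp p" "\<lambda>x y. lp_norm p (\<lambda>j. x j - y j)" by (rule Metric_space_lp[OF p])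
  let ?B = "{x \<in> lp p. lp_norm p x \<le> 1}"
  let ?C = "M.mtopology closure_of (K ` ?B)"
  have "compactin M.mtopology ?C \<longleftrightarrow> ?seq" if K: "K \<in> lp_operators p"
  proof
    have sub: "K ` ?B \<subseteq> lp p" using lp_operator_in_lp[OF K] by auto
    show ?seq if comp: "compactin M.mtopology ?C"
    proof (intro allI impI)
      fix s :: "nat \<Rightarrow> nat \<Rightarrow> complex"
      assume s: "\<forall>n. s n \<in> lp p \<and> lp_norm p (s n) \<le> 1"
      then have "range (K \<circ> s) \<subseteq> ?C"
        using closure_of_subset[of "K ` ?B" M.mtopology] sub by auto
      then obtain l r where "l \<in> ?C" "strict_mono r" "limitin M.mtopology (K \<circ> s \<circ> r) l sequentially"
        using comp unfolding M.compactin_sequentially by blast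
      then show "\<exists>l r. strict_mono r \<and> l \<in> lp p \<and> (\<lambda>n. lp_norm p (\<lambda>j. K (s (r n)) j - l j)) \<longlonglongrightarrow> 0"
        by (auto simp: M.limitin_metric_dist_null)
    qed
    show "compactin M.mtopology ?C" if seq: ?seq
      unfolding M.compactin_sequentially
    proof (intro conjI allI impI)
      show "?C \<subseteq> lp p" using closure_of_subset_topspace[of M.mtopology] by simp
      fix \<sigma> :: "nat \<Rightarrow> nat \<Rightarrow> complex"
      assume \<sigma>: "range \<sigma> \<subseteq> ?C"
      then have \<sigma>l: "\<sigma> n \<in> lp p" for n using \<open>?C \<subseteq> lp p\<close> by auto
      have "\<exists>x. x \<in> ?B \<and> lp_norm p (\<lambda>j. \<sigma> n j - K x j) < 1 / Suc n" for n
      proof -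
        have "\<sigma> n \<in> ?C" using \<sigma> by auto
        then have "\<forall>r>0. \<exists>y\<in>K ` ?B. y \<in> M.mball (\<sigma> n) r"
          unfolding M.metric_closure_of mem_Collect_eq by (rule conjunct2)
        moreover have "1 / real (Suc n) > 0" by simp
        ultimately obtain y where "y \<in> K ` ?B" "y \<in> M.mball (\<sigma> n) (1 / Suc n)" by blast
        then show ?thesis by (auto simp only: M.in_mball image_iff)
      qed
      then have "\<exists>s. \<forall>n. s n \<in> ?B \<and> lp_norm p (\<lambda>j. \<sigma> n j - K (s n) j) < 1 / Suc n"
        by (intro choice allI)
      then obtain s where s: "\<And>n. s n \<in> ?B" "\<And>n. lp_norm p (\<lambda>j. \<sigma> n j - K (s n) j) < 1 / Suc n"
        by blast
      have "\<forall>n. s n \<in> lp p \<and> lp_norm p (s n) \<le> 1" using s(1) by simp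
      with seq[THEN spec[of _ s]] obtain l r
        where lr: "strict_mono r" "l \<in> lp p" "(\<lambda>n. lp_norm p (\<lambda>j. K (s (r n)) j - l j)) \<longlonglongrightarrow> 0"
        by blast
      have near: "(\<lambda>n. lp_norm p (\<lambda>j. \<sigma> (r n) j - K (s (r n)) j)) \<longlonglongrightarrow> 0"
      proof (rule tendsto_sandwich[OF _ _ tendsto_const])
        show "(\<lambda>n. 1 / real (Suc (r n))) \<longlonglongrightarrow> 0"
          using LIMSEQ_subseq_LIMSEQ[OF LIMSEQ_inverse_real_of_nat lr(1)] by (simp add: o_def inverse_eq_divide)
      qed (use s(2) in \<open>auto intro!: always_eventually less_imp_le\<close>)
      have "(\<lambda>n. lp_norm p (\<lambda>j. \<sigma> (r n) j - l j)) \<longlonglongrightarrow> 0"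
      proof (rule tendsto_sandwich[OF _ _ tendsto_const])
        show "(\<lambda>n. lp_norm p (\<lambda>j. \<sigma> (r n) j - K (s (r n)) j) + lp_norm p (\<lambda>j. K (s (r n)) j - l j)) \<longlonglongrightarrow> 0"
          using tendsto_add[OF near lr(3)] by simp
        have "lp_norm p (\<lambda>j. \<sigma> (r n) j - l j)
            \<le> lp_norm p (\<lambda>j. \<sigma> (r n) j - K (s (r n)) j) + lp_norm p (\<lambda>j. K (s (r n)) j - l j)" for n
          using M.triangle[OF \<sigma>l[of "r n"] _ lr(2), of "K (s (r n))"] lp_operator_in_lp[OF K] s(1) by auto
        then show "\<forall>\<^sub>F n in sequentially. lp_norm p (\<lambda>j. \<sigma> (r n) j - l j)
            \<le> lp_norm p (\<lambda>j. \<sigma> (r n) j - K (s (r n)) j) + lp_norm p (\<lambda>j. K (s (r n)) j - l j)"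
          by simp
      qed simp
      then have lim: "limitin M.mtopology (\<sigma> \<circ> r) l sequentially"
        using lr(2) \<sigma>l by (simp add: M.limitin_metric_dist_null)
      then have "l \<in> ?C"
        by (rule limitin_closedin) (use subsetD[OF \<sigma> rangeI] in \<open>simp_all add: always_eventually\<close>)
      then show "\<exists>l r. l \<in> ?C \<and> strict_mono r \<and> limitin M.mtopology (\<sigma> \<circ> r) l sequentially"
        using lim lr(1) by blast
    qed
  qed
  then show ?thesis
    unfolding lp_compact_operators_def lp_topology_def mem_Collect_eq by (rule conj_cong[OF refl])
qed

lemma compact_operator_closed: "K \<in> lp_compact_operators p \<Longrightarrow> K \<in> lp_operators p"
  by (simp add: compact_operator_iff)

text \<open>The criterion extends from the unit ball to every bounded sequence by rescaling.\<close>

lemma compact_operatorD: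
  assumes K: "K \<in> lp_compact_operators p" and s: "\<And>n :: nat. s n \<in> lp p" "\<And>n. lp_norm p (s n) \<le> C"
  obtains l r where "strict_mono r" "l \<in> lp p" "(\<lambda>n. lp_norm p (\<lambda>j. K (s (r n)) j - l j)) \<longlonglongrightarrow> 0"
proof -
  \<comment> \<open>The bound \<open>C\<close> may be zero, and the scaling factor has to be positive.\<close>
  define c where "c = max C 1"
  then have c: "c > 0" by auto
  have Ko: "K \<in> lp_operators p" by (rule compact_operator_closed[OF K])
  let ?s = "\<lambda>n. seq_scale (1 / c) (s n)"
  have "?s n \<in> lp p \<and> lp_norm p (?s n) \<le> 1" for n
    using s(2)[of n] c
    by (simp add: seq_scale_in_lp[OF p s(1)] lp_norm_scale[OF p s(1)] norm_divide c_def)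
  then obtain l r where lr: "strict_mono r" "l \<in> lp p" "(\<lambda>n. lp_norm p (\<lambda>j. K (?s (r n)) j - l j)) \<longlonglongrightarrow> 0"
    using K[unfolded compact_operator_iff, THEN conjunct2, THEN spec[of _ ?s]] by blast
  have "lp_norm p (\<lambda>j. K (s (r n)) j - seq_scale c l j) = c * lp_norm p (\<lambda>j. K (?s (r n)) j - l j)" for n
  proof -
    have "(\<lambda>j. K (s (r n)) j - seq_scale c l j) = seq_scale c (\<lambda>j. K (?s (r n)) j - l j)"
      using c by (simp add: lp_operator_scale[OF Ko s(1)] fun_eq_iff right_diff_distrib)
    then show ?thesis
      using c lr(2) by (simp add: lp_norm_scale[OF p] seq_diff_in_lp[OF p] lp_operator_in_lp[OF Ko]
          seq_scale_in_lp[OF p] s(1))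
  qed
  then have "(\<lambda>n. lp_norm p (\<lambda>j. K (s (r n)) j - seq_scale c l j)) \<longlonglongrightarrow> 0"
    using tendsto_mult_left[OF lr(3), of c] by simp
  then show thesis
    using that[OF lr(1) seq_scale_in_lp[OF p lr(2)]] by blast
qed

lemma compact_operatorI:
  assumes "K \<in> lp_operators p"
    and "\<And>s. (\<And>n :: nat. s n \<in> lp p) \<Longrightarrow> (\<And>n. lp_norm p (s n) \<le> 1) \<Longrightarrow>
      \<exists>l r. strict_mono r \<and> l \<in> lp p \<and> (\<lambda>n. lp_norm p (\<lambda>j. K (s (r n)) j - l j)) \<longlonglongrightarrow> 0"
  shows "K \<in> lp_compact_operators p"
  unfolding compact_operator_iff using assms by auto

lemma lp_norm_tendsto_sandwich:
  assumes "f \<longlonglongrightarrow> 0" and "\<And>n. lp_norm p (u n) \<le> f n"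
  shows "(\<lambda>n. lp_norm p (u n)) \<longlonglongrightarrow> 0"
  by (rule tendsto_sandwich[OF _ _ tendsto_const assms(1)]) (use assms(2) in auto)

lemma compact_operator_add:
  assumes K: "K \<in> lp_compact_operators p" and L: "L \<in> lp_compact_operators p"
  shows "K \<oplus>\<^bsub>lp_operator_algebra p\<^esub> L \<in> lp_compact_operators p"
proof (rule compact_operatorI)
  note Ko = compact_operator_closed[OF K] and Lo = compact_operator_closed[OF L]
  show "K \<oplus>\<^bsub>lp_operator_algebra p\<^esub> L \<in> lp_operators p" using Ko Lo by auto
  fix s :: "nat \<Rightarrow> nat \<Rightarrow> complex" assume s: "\<And>n. s n \<in> lp p" "\<And>n. lp_norm p (s n) \<le> 1"
  obtain l r where lr: "strict_mono r" "l \<in> lp p" "(\<lambda>n. lp_norm p (\<lambda>j. K (s (r n)) j - l j)) \<longlonglongrightarrow> 0"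
    by (rule compact_operatorD[OF K s])
  obtain l' r' where lr': "strict_mono r'" "l' \<in> lp p" "(\<lambda>n. lp_norm p (\<lambda>j. L (s (r (r' n))) j - l' j)) \<longlonglongrightarrow> 0"
    by (rule compact_operatorD[OF L, of "\<lambda>n. s (r n)" 1]) (use s in auto)
  have "(\<lambda>n. lp_norm p (\<lambda>j. K (s (r (r' n))) j - l j) + lp_norm p (\<lambda>j. L (s (r (r' n))) j - l' j)) \<longlonglongrightarrow> 0"
    using tendsto_add[OF LIMSEQ_subseq_LIMSEQ[OF lr(3) lr'(1)] lr'(3)] by (simp add: o_def)
  moreover have "lp_norm p (\<lambda>j. (K \<oplus>\<^bsub>lp_operator_algebra p\<^esub> L) (s ((r \<circ> r') n)) j - seq_add l l' j)
      \<le> lp_norm p (\<lambda>j. K (s (r (r' n))) j - l j) + lp_norm p (\<lambda>j. L (s (r (r' n))) j - l' j)" for n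
  proof -
    have "(\<lambda>j. (K \<oplus>\<^bsub>lp_operator_algebra p\<^esub> L) (s ((r \<circ> r') n)) j - seq_add l l' j)
      = seq_add (\<lambda>j. K (s (r (r' n))) j - l j) (\<lambda>j. L (s (r (r' n))) j - l' j)"
      using s(1) by (simp add: fun_eq_iff)
    then show ?thesis
      using s(1) lr(2) lr'(2) lp_operator_in_lp[OF Ko] lp_operator_in_lp[OF Lo]
      by (simp add: lp_norm_triangle[OF p] seq_diff_in_lp[OF p])
  qed
  ultimately have "(\<lambda>n. lp_norm p (\<lambda>j. (K \<oplus>\<^bsub>lp_operator_algebra p\<^esub> L) (s ((r \<circ> r') n)) j - seq_add l l' j)) \<longlonglongrightarrow> 0"
    by (rule lp_norm_tendsto_sandwich)
  then show "\<exists>l r. strict_mono r \<and> l \<in> lp p \<and>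
      (\<lambda>n. lp_norm p (\<lambda>j. (K \<oplus>\<^bsub>lp_operator_algebra p\<^esub> L) (s (r n)) j - l j)) \<longlonglongrightarrow> 0"
    using seq_add_in_lp[OF p lr(2) lr'(2)] strict_mono_o[OF lr(1) lr'(1)] by blast
qed

lemma compact_operator_mult_left:
  assumes T: "T \<in> lp_operators p" and K: "K \<in> lp_compact_operators p"
  shows "T \<otimes>\<^bsub>lp_operator_algebra p\<^esub> K \<in> lp_compact_operators p"
proof (rule compact_operatorI)
  note Ko = compact_operator_closed[OF K]
  show "T \<otimes>\<^bsub>lp_operator_algebra p\<^esub> K \<in> lp_operators p" using T Ko by auto
  fix s :: "nat \<Rightarrow> nat \<Rightarrow> complex" assume s: "\<And>n. s n \<in> lp p" "\<And>n. lp_norm p (s n) \<le> 1"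
  obtain l r where lr: "strict_mono r" "l \<in> lp p" "(\<lambda>n. lp_norm p (\<lambda>j. K (s (r n)) j - l j)) \<longlonglongrightarrow> 0"
    by (rule compact_operatorD[OF K s])
  have "(\<lambda>n. lp_op_norm p T * lp_norm p (\<lambda>j. K (s (r n)) j - l j)) \<longlonglongrightarrow> 0"
    using tendsto_mult_left[OF lr(3)] by simp
  moreover have "lp_norm p (\<lambda>j. (T \<otimes>\<^bsub>lp_operator_algebra p\<^esub> K) (s (r n)) j - T l j)
      \<le> lp_op_norm p T * lp_norm p (\<lambda>j. K (s (r n)) j - l j)" for n
    using lp_op_norm_bound[OF T seq_diff_in_lp[OF p lp_operator_in_lp[OF Ko s(1)[of "r n"]] lr(2)]]
      lp_operator_diff[OF T lp_operator_in_lp[OF Ko s(1)[of "r n"]] lr(2)] s(1) by simp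
  ultimately have "(\<lambda>n. lp_norm p (\<lambda>j. (T \<otimes>\<^bsub>lp_operator_algebra p\<^esub> K) (s (r n)) j - T l j)) \<longlonglongrightarrow> 0"
    by (rule lp_norm_tendsto_sandwich)
  then show "\<exists>l r. strict_mono r \<and> l \<in> lp p \<and>
      (\<lambda>n. lp_norm p (\<lambda>j. (T \<otimes>\<^bsub>lp_operator_algebra p\<^esub> K) (s (r n)) j - l j)) \<longlonglongrightarrow> 0"
    using lp_operator_in_lp[OF T lr(2)] lr(1) by blast
qed

lemma compact_operator_mult_right:
  assumes T: "T \<in> lp_operators p" and K: "K \<in> lp_compact_operators p"
  shows "K \<otimes>\<^bsub>lp_operator_algebra p\<^esub> T \<in> lp_compact_operators p"
proof (rule compact_operatorI)
  show "K \<otimes>\<^bsub>lp_operator_algebra p\<^esub> T \<in> lp_operators p" using T compact_operator_closed[OF K] by auto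
  fix s :: "nat \<Rightarrow> nat \<Rightarrow> complex" assume s: "\<And>n. s n \<in> lp p" "\<And>n. lp_norm p (s n) \<le> 1"
  obtain l r where "strict_mono r" "l \<in> lp p" "(\<lambda>n. lp_norm p (\<lambda>j. K (T (s (r n))) j - l j)) \<longlonglongrightarrow> 0"
    by (rule compact_operatorD[OF K lp_operator_in_lp[OF T s(1)] lp_op_norm_upper[OF T s(1) s(2)]])
  then show "\<exists>l r. strict_mono r \<and> l \<in> lp p \<and>
      (\<lambda>n. lp_norm p (\<lambda>j. (K \<otimes>\<^bsub>lp_operator_algebra p\<^esub> T) (s (r n)) j - l j)) \<longlonglongrightarrow> 0"
    using s(1) by auto
qed

lemma compact_operator_scale:
  assumes K: "K \<in> lp_compact_operators p"
  shows "c \<odot>\<^bsub>lp_operator_algebra p\<^esub> K \<in> lp_compact_operators p"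
proof -
  note Ko = compact_operator_closed[OF K]
  have "c \<odot>\<^bsub>lp_operator_algebra p\<^esub> K = (c \<odot>\<^bsub>lp_operator_algebra p\<^esub> \<one>\<^bsub>lp_operator_algebra p\<^esub>) \<otimes>\<^bsub>lp_operator_algebra p\<^esub> K"
    using Ko by (intro lp_operators_eqI[of _ p]) (auto simp: lp_operator_in_lp[OF Ko])
  then show ?thesis
    using compact_operator_mult_left[OF _ K, of "c \<odot>\<^bsub>lp_operator_algebra p\<^esub> \<one>\<^bsub>lp_operator_algebra p\<^esub>"] by auto
qed

lemma zero_operator_compact: "\<zero>\<^bsub>lp_operator_algebra p\<^esub> \<in> lp_compact_operators p"
  by (intro compact_operatorI exI[of _ "\<lambda>j. 0"] exI[of _ id])
    (auto simp: zero_in_lp[OF p] lp_norm_zero[OF p] strict_mono_def)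

text \<open>A projection onto finitely many coordinates is a sum of projections onto a single one, and
  those are compact by the theorem of Bolzano and Weierstrass in the complex plane.\<close>

lemma head_operator_compact: "head_operator p N \<in> lp_compact_operators p"
proof (induction N)
  case 0
  have "head_operator p 0 = \<zero>\<^bsub>lp_operator_algebra p\<^esub>"
    by (intro lp_operators_eqI[of _ p]) (auto simp: seq_head_def)
  then show ?case using zero_operator_compact by simp
next
  case (Suc N)
  define e where "e z = (\<lambda>j. if j = N then z else 0)" for z :: complex
  have norm_e: "lp_norm p (e z) = cmod z" for z
  proof -
    have "(\<lambda>j. cmod (e z j) powr p) = (\<lambda>j. if j = N then cmod z powr p else 0)"
      using p by (auto simp: e_def)
    then have "(\<Sum>j. cmod (e z j) powr p) = cmod z powr p"
      using sums_unique[OF sums_single[of N "\<lambda>_. cmod z powr p"]] by simp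
    then show ?thesis using p by (simp add: lp_norm_def powr_powr)
  qed
  have lp_e: "e z \<in> lp p" for z
    by (auto simp: lp_def e_def intro!: summable_finite[of "{N}"] split: if_splits)
  let ?E = "\<lambda>x\<in>lp p. e (x N)"
  have E: "?E \<in> lp_operators p"
    by (rule lp_operatorsI[where C = 1])
      (auto simp: seq_add_in_lp[OF p] seq_scale_in_lp[OF p] lp_e norm_e coordinate_le_lp_norm[OF p],
        auto simp: e_def fun_eq_iff)
  have "?E \<in> lp_compact_operators p"
  proof (rule compact_operatorI[OF E])
    fix s :: "nat \<Rightarrow> nat \<Rightarrow> complex" assume s: "\<And>n. s n \<in> lp p" "\<And>n. lp_norm p (s n) \<le> 1"
    have "cmod (s n N) \<le> 1" for n
      using coordinate_le_lp_norm[OF p s(1)[of n], of N] s(2)[of n] by linarith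
    then have "\<forall>n. s n N \<in> cball 0 1" by simp
    then obtain z r where zr: "strict_mono r" "(\<lambda>n. s (r n) N) \<longlonglongrightarrow> z"
      using compact_cball[of "0::complex" 1, unfolded compact_def o_def, THEN spec[of _ "\<lambda>n. s n N"]] by blast
    have "lp_norm p (\<lambda>j. ?E (s (r n)) j - e z j) = cmod (s (r n) N - z)" for n
    proof -
      have "(\<lambda>j. ?E (s (r n)) j - e z j) = e (s (r n) N - z)"
        using s(1) by (auto simp: e_def fun_eq_iff)
      then show ?thesis by (simp only: norm_e)
    qed
    then have "(\<lambda>n. lp_norm p (\<lambda>j. ?E (s (r n)) j - e z j)) \<longlonglongrightarrow> 0"
      using zr(2) by (simp add: LIM_zero_iff tendsto_norm_zero_iff)
    then show "\<exists>l r. strict_mono r \<and> l \<in> lp p \<and> (\<lambda>n. lp_norm p (\<lambda>j. ?E (s (r n)) j - l j)) \<longlonglongrightarrow> 0"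
      using zr(1) lp_e[of z] by blast
  qed
  moreover have "head_operator p (Suc N) = head_operator p N \<oplus>\<^bsub>lp_operator_algebra p\<^esub> ?E"
    using E by (intro lp_operators_eqI[of _ p]) (auto simp: seq_head_def e_def)
  ultimately show ?case using compact_operator_add[OF Suc.IH] by simp
qed

text \<open>A compact operator turns weak convergence to zero into convergence in norm: a norm limit of a
  subsequence of the images has vanishing coordinates.\<close>

lemma compact_operator_weakly_null:
  assumes K: "K \<in> lp_compact_operators p"
    and x: "\<And>n. x n \<in> lp p" "\<And>n. lp_norm p (x n) \<le> 1" and null: "lp_weakly_null p x"
  shows "(\<lambda>n. lp_norm p (K (x n))) \<longlonglongrightarrow> 0"
proof (rule ccontr)
  assume "\<not> ?thesis"
  then obtain \<epsilon> where \<epsilon>: "\<epsilon> > 0" and often: "\<forall>n0. \<exists>n\<ge>n0. \<epsilon> \<le> lp_norm p (K (x n))"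
    unfolding LIMSEQ_iff by (auto simp: not_less)
  then have "infinite {n. \<epsilon> \<le> lp_norm p (K (x n))}"
    unfolding infinite_nat_iff_unbounded_le by auto
  then obtain r0 :: "nat \<Rightarrow> nat" where r0: "strict_mono r0" "\<And>n. \<epsilon> \<le> lp_norm p (K (x (r0 n)))"
    using infinite_enumerate by blast
  note Ko = compact_operator_closed[OF K]
  obtain l r where lr: "strict_mono r" "l \<in> lp p" "(\<lambda>n. lp_norm p (\<lambda>j. K (x (r0 (r n))) j - l j)) \<longlonglongrightarrow> 0"
    by (rule compact_operatorD[OF K, of "\<lambda>n. x (r0 n)" 1]) (use x in auto)
  have mono: "strict_mono (r0 \<circ> r)" by (rule strict_mono_o[OF r0(1) lr(1)])
  have "l j = 0" for j
  proof -
    have "(\<lambda>n. K (x n) j) \<longlonglongrightarrow> 0"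
      by (rule bspec[OF null[unfolded lp_weakly_null_def] coordinate_functional[OF Ko, of j]])
    from LIMSEQ_subseq_LIMSEQ[OF this mono] have "(\<lambda>n. K (x (r0 (r n))) j) \<longlonglongrightarrow> 0"
      by (simp add: o_def)
    moreover have "(\<lambda>n. K (x (r0 (r n))) j - l j) \<longlonglongrightarrow> 0"
    proof (rule Lim_null_comparison[OF always_eventually lr(3)], intro allI)
      show "norm (K (x (r0 (r n))) j - l j) \<le> lp_norm p (\<lambda>j. K (x (r0 (r n))) j - l j)" for n
        using coordinate_le_lp_norm[OF p seq_diff_in_lp[OF p lp_operator_in_lp[OF Ko x(1)] lr(2)]] by simp
    qed
    ultimately show ?thesis
      by (metis LIMSEQ_unique LIM_zero_cancel)
  qed
  then have "(\<lambda>n. lp_norm p (K (x (r0 (r n))))) \<longlonglongrightarrow> 0" using lr(3) by simp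
  then have "\<epsilon> \<le> 0"
    by (rule tendsto_lowerbound) (use r0(2) in auto)
  then show False using \<epsilon> by simp
qed

end

section \<open>States of the Calkin algebra\<close>

text \<open>A state of the Calkin algebra is encoded by its pullback to the operators, so that no cosets occur in
  the estimates; that it factors through the quotient is the last condition.\<close>

definition calkin_state :: "real \<Rightarrow> (((nat \<Rightarrow> complex) \<Rightarrow> nat \<Rightarrow> complex) \<Rightarrow> complex) \<Rightarrow> bool" where
  "calkin_state p g \<longleftrightarrow>
     (\<forall>S\<in>lp_operators p. \<forall>T\<in>lp_operators p. g (S \<oplus>\<^bsub>lp_operator_algebra p\<^esub> T) = g S + g T) \<and>
     (\<forall>c. \<forall>S\<in>lp_operators p. g (c \<odot>\<^bsub>lp_operator_algebra p\<^esub> S) = c * g S) \<and>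
     (\<forall>S\<in>lp_operators p. cmod (g S) \<le> lp_op_norm p S) \<and>
     g \<one>\<^bsub>lp_operator_algebra p\<^esub> = 1 \<and>
     (\<forall>K\<in>lp_compact_operators p. g K = 0)"

context
  fixes p :: real
  assumes p: "1 < p"
begin

lemma abelian_subgroup_compact_operators:
  "abelian_subgroup (lp_compact_operators p) (lp_operator_algebra p)"
proof (rule abelian_subgroupI3[OF additive_subgroupI abelian_group_lp_operators[OF p]], rule subgroup.intro)
  fix K assume K: "K \<in> lp_compact_operators p"
  show "inv\<^bsub>add_monoid (lp_operator_algebra p)\<^esub> K \<in> lp_compact_operators p"
    using minus_operator_eq[OF p compact_operator_closed[OF p K]] compact_operator_scale[OF p K, of "-1"]
    by (simp add: a_inv_def)
qed (auto simp: compact_operator_closed[OF p] compact_operator_add[OF p] zero_operator_compact[OF p])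

interpretation K: abelian_subgroup "lp_compact_operators p" "lp_operator_algebra p"
  by (rule abelian_subgroup_compact_operators)

lemma mem_calkin_proj:
  "R \<in> calkin_proj p S \<longleftrightarrow> (\<exists>K\<in>lp_compact_operators p. R = K \<oplus>\<^bsub>lp_operator_algebra p\<^esub> S)"
  by (auto simp: calkin_proj_def a_r_coset_def')

lemma calkin_proj_self: "S \<in> lp_operators p \<Longrightarrow> S \<in> calkin_proj p S"
  using K.a_rcos_self[of S] by (simp add: calkin_proj_def)

lemma calkin_proj_eqI:
  assumes "S \<in> lp_operators p" "K \<in> lp_compact_operators p"
  shows "calkin_proj p (K \<oplus>\<^bsub>lp_operator_algebra p\<^esub> S) = calkin_proj p S"
proof -
  have "K \<oplus>\<^bsub>lp_operator_algebra p\<^esub> S \<in> calkin_proj p S"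
    unfolding mem_calkin_proj using assms(2) by blast
  then show ?thesis
    using K.a_repr_independence'[of "K \<oplus>\<^bsub>lp_operator_algebra p\<^esub> S" S] assms(1) by (simp add: calkin_proj_def)
qed

lemma calkin_carrier: "carrier (calkin_algebra p) = calkin_proj p ` lp_operators p"
  by (auto simp: calkin_algebra_def quotient_algebra_def FactRing_def A_RCOSETS_def' calkin_proj_def)

lemma calkin_add:
  assumes "S \<in> lp_operators p" "T \<in> lp_operators p"
  shows "calkin_proj p S \<oplus>\<^bsub>calkin_algebra p\<^esub> calkin_proj p T = calkin_proj p (S \<oplus>\<^bsub>lp_operator_algebra p\<^esub> T)"
  using assms K.a_rcos_sum[of S T]
  by (simp add: calkin_algebra_def quotient_algebra_def FactRing_def calkin_proj_def)

lemma calkin_one: "\<one>\<^bsub>calkin_algebra p\<^esub> = calkin_proj p \<one>\<^bsub>lp_operator_algebra p\<^esub>"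
  by (simp add: calkin_algebra_def quotient_algebra_def FactRing_def calkin_proj_def)

lemma calkin_scale:
  assumes S: "S \<in> lp_operators p"
  shows "c \<odot>\<^bsub>calkin_algebra p\<^esub> calkin_proj p S = calkin_proj p (c \<odot>\<^bsub>lp_operator_algebra p\<^esub> S)"
proof -
  have "calkin_proj p (c \<odot>\<^bsub>lp_operator_algebra p\<^esub> R) = calkin_proj p (c \<odot>\<^bsub>lp_operator_algebra p\<^esub> S)"
    if "R \<in> calkin_proj p S" for R
  proof -
    obtain K where K: "K \<in> lp_compact_operators p" "R = K \<oplus>\<^bsub>lp_operator_algebra p\<^esub> S"
      using \<open>R \<in> calkin_proj p S\<close> unfolding mem_calkin_proj by blast
    have "c \<odot>\<^bsub>lp_operator_algebra p\<^esub> R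
        = (c \<odot>\<^bsub>lp_operator_algebra p\<^esub> K) \<oplus>\<^bsub>lp_operator_algebra p\<^esub> (c \<odot>\<^bsub>lp_operator_algebra p\<^esub> S)"
      using S compact_operator_closed[OF p K(1)] unfolding K(2)
      by (intro lp_operators_eqI[of _ p] add_operator_closed[OF p] scale_operator_closed[OF p])
        (simp_all add: distrib_left)
    then show ?thesis
      using calkin_proj_eqI[OF scale_operator_closed[OF p S] compact_operator_scale[OF p K(1)]] by simp
  qed
  moreover have "c \<odot>\<^bsub>calkin_algebra p\<^esub> calkin_proj p S
      = (\<Union>R\<in>calkin_proj p S. calkin_proj p (c \<odot>\<^bsub>lp_operator_algebra p\<^esub> R))"
    by (simp add: calkin_algebra_def quotient_algebra_def calkin_proj_def)
  ultimately have "c \<odot>\<^bsub>calkin_algebra p\<^esub> calkin_proj p S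
      = (\<Union>R\<in>calkin_proj p S. calkin_proj p (c \<odot>\<^bsub>lp_operator_algebra p\<^esub> S))"
    by (simp cong: SUP_cong)
  then show ?thesis using calkin_proj_self[OF S] by (simp only: UN_constant split: if_split) blast
qed

lemma calkin_norm:
  "alg_norm (calkin_algebra p) (calkin_proj p S) = (INF R\<in>calkin_proj p S. lp_op_norm p R)"
  by (simp add: calkin_algebra_def quotient_algebra_def)

lemma calkin_norm_le:
  assumes S: "S \<in> lp_operators p"
  shows "alg_norm (calkin_algebra p) (calkin_proj p S) \<le> lp_op_norm p S"
  unfolding calkin_norm
proof (rule cINF_lower[OF _ calkin_proj_self[OF S]], rule bdd_belowI2)
  fix R assume "R \<in> calkin_proj p S"
  then have "R \<in> lp_operators p"
    using add_operator_closed[OF p compact_operator_closed[OF p] S] by (auto simp: mem_calkin_proj)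
  then show "0 \<le> lp_op_norm p R" by (rule lp_op_norm_nonneg[OF p])
qed

lemma one_operator_norm_le: "lp_op_norm p \<one>\<^bsub>lp_operator_algebra p\<^esub> \<le> 1"
  by (rule lp_op_norm_least[OF p]) simp

lemma scale_operator_norm_le:
  assumes S: "S \<in> lp_operators p"
  shows "lp_op_norm p (c \<odot>\<^bsub>lp_operator_algebra p\<^esub> S) \<le> cmod c * lp_op_norm p S"
  by (rule lp_op_norm_least[OF p])
    (simp add: lp_norm_scale[OF p lp_operator_in_lp[OF S]] lp_op_norm_upper[OF p S] mult_left_mono)

text \<open>The dual norm bounds the values of a functional only on the unit ball of the quotient, so for an
  operator \<open>S\<close> it is applied to \<open>S / r\<close> for every number \<open>r\<close> above the norm of \<open>S\<close>.\<close>

lemma calkin_state_of_functional: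
  assumes f: "f \<in> dual_space (carrier (calkin_algebra p)) (add (calkin_algebra p))
                 (Module.smult (calkin_algebra p)) (alg_norm (calkin_algebra p))"
    and norm: "dual_norm (carrier (calkin_algebra p)) (alg_norm (calkin_algebra p)) f = 1"
    and one: "f \<one>\<^bsub>calkin_algebra p\<^esub> = 1"
  shows "calkin_state p (\<lambda>S. f (calkin_proj p S))"
proof -
  let ?C = "calkin_algebra p"
  have add: "f (calkin_proj p (S \<oplus>\<^bsub>lp_operator_algebra p\<^esub> T)) = f (calkin_proj p S) + f (calkin_proj p T)"
    if "S \<in> lp_operators p" "T \<in> lp_operators p" for S T
    using f that unfolding dual_space_def by (simp add: calkin_carrier calkin_add)
  have scale: "f (calkin_proj p (c \<odot>\<^bsub>lp_operator_algebra p\<^esub> S)) = c * f (calkin_proj p S)"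
    if "S \<in> lp_operators p" for c S
    using f that unfolding dual_space_def by (simp add: calkin_carrier calkin_scale)
  obtain B where B: "\<And>X. X \<in> carrier ?C \<Longrightarrow> cmod (f X) \<le> B * alg_norm ?C X"
    using f unfolding dual_space_def by blast
  have pos: "0 \<le> alg_norm ?C X" if X: "X \<in> carrier ?C" for X
  proof -
    obtain S where S: "S \<in> lp_operators p" "X = calkin_proj p S"
      using X by (auto simp: calkin_carrier)
    show ?thesis
      unfolding S(2) calkin_norm
    proof (rule cINF_greatest)
      show "calkin_proj p S \<noteq> {}" using calkin_proj_self[OF S(1)] by blast
      fix R assume "R \<in> calkin_proj p S"
      then have "R \<in> lp_operators p"
        using add_operator_closed[OF p compact_operator_closed[OF p] S(1)] by (auto simp: mem_calkin_proj)
      then show "0 \<le> lp_op_norm p R" by (rule lp_op_norm_nonneg[OF p])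
    qed
  qed
  have ball: "cmod (f X) \<le> 1" if X: "X \<in> carrier ?C" "alg_norm ?C X \<le> 1" for X
  proof -
    have "bdd_above ((\<lambda>X. cmod (f X)) ` {X \<in> carrier ?C. alg_norm ?C X \<le> 1})"
    proof (rule bdd_aboveI2)
      fix X assume X: "X \<in> {X \<in> carrier ?C. alg_norm ?C X \<le> 1}"
      then have "cmod (f X) \<le> B * alg_norm ?C X" using B by auto
      also have "\<dots> \<le> \<bar>B\<bar> * 1" using X pos[of X] by (intro mult_mono) auto
      finally show "cmod (f X) \<le> \<bar>B\<bar>" by simp
    qed
    then have "cmod (f X) \<le> dual_norm (carrier ?C) (alg_norm ?C) f"
      unfolding dual_norm_def using X by (intro cSUP_upper[of X _ "\<lambda>X. cmod (f X)"]) simp_all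
    then show ?thesis using norm by simp
  qed
  have bound: "cmod (f (calkin_proj p S)) \<le> lp_op_norm p S" if S: "S \<in> lp_operators p" for S
  proof (rule field_le_epsilon)
    fix e :: real assume e: "e > 0"
    define r where "r = lp_op_norm p S + e"
    have r: "r > 0" using lp_op_norm_nonneg[OF p S] e by (simp add: r_def)
    let ?R = "complex_of_real (1 / r) \<odot>\<^bsub>lp_operator_algebra p\<^esub> S"
    have R: "?R \<in> lp_operators p" by (rule scale_operator_closed[OF p S])
    have "alg_norm ?C (calkin_proj p ?R) \<le> lp_op_norm p ?R" by (rule calkin_norm_le[OF R])
    also have "\<dots> \<le> 1 / r * lp_op_norm p S"
      using scale_operator_norm_le[OF S, of "complex_of_real (1 / r)"] r by (simp add: norm_divide)
    also have "\<dots> \<le> 1" using r e by (simp add: r_def)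
    finally have "cmod (f (calkin_proj p ?R)) \<le> 1"
      using R by (intro ball) (auto simp: calkin_carrier)
    then have "cmod (f (calkin_proj p S)) \<le> r"
      using r unfolding scale[OF S] by (simp add: norm_mult norm_divide)
    then show "cmod (f (calkin_proj p S)) \<le> lp_op_norm p S + e" by (simp only: r_def)
  qed
  have compact: "f (calkin_proj p K) = 0" if K: "K \<in> lp_compact_operators p" for K
  proof -
    let ?Z = "\<zero>\<^bsub>lp_operator_algebra p\<^esub>"
    have Z: "?Z \<in> lp_operators p" by (rule zero_operator_closed[OF p])
    have "K \<oplus>\<^bsub>lp_operator_algebra p\<^esub> ?Z = K"
      using compact_operator_closed[OF p K] Z
      by (intro lp_operators_eqI[of _ p] add_operator_closed[OF p]) simp_all
    then have "calkin_proj p K = calkin_proj p ?Z" using calkin_proj_eqI[OF Z K] by simp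
    moreover have "f (calkin_proj p ?Z) = 0"
      using add[OF Z Z] Z K.a_closed by simp
    ultimately show ?thesis by simp
  qed
  show ?thesis
    unfolding calkin_state_def using add scale bound compact one by (simp add: calkin_one)
qed

text \<open>A functional that annihilates the compact operators is constant on the cosets, so a value on the
  quotient is read off at any representative. As the bound \<open>\<bar>g R\<bar> \<le> \<parallel>R\<parallel>\<close> holds at every
  representative \<open>R\<close>, it passes to the infimum that is the quotient norm.\<close>

lemma functional_of_calkin_state:
  assumes g: "calkin_state p g"
  obtains f where "f \<in> dual_space (carrier (calkin_algebra p)) (add (calkin_algebra p))
                 (Module.smult (calkin_algebra p)) (alg_norm (calkin_algebra p))"
    and "dual_norm (carrier (calkin_algebra p)) (alg_norm (calkin_algebra p)) f = 1"
    and "f \<one>\<^bsub>calkin_algebra p\<^esub> = 1" and "\<And>S. S \<in> lp_operators p \<Longrightarrow> f (calkin_proj p S) = g S"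
proof -
  let ?C = "calkin_algebra p"
  define f where "f X = g (SOME R. R \<in> X)" for X
  have inv: "g R = g S" if S: "S \<in> lp_operators p" and R: "R \<in> calkin_proj p S" for R S
  proof -
    obtain K where K: "K \<in> lp_compact_operators p" "R = K \<oplus>\<^bsub>lp_operator_algebra p\<^esub> S"
      using R unfolding mem_calkin_proj by blast
    then show ?thesis
      using g S compact_operator_closed[OF p K(1)] unfolding calkin_state_def by simp
  qed
  have f: "f (calkin_proj p S) = g S" if S: "S \<in> lp_operators p" for S
    unfolding f_def by (rule inv[OF S someI[of "\<lambda>R. R \<in> calkin_proj p S", OF calkin_proj_self[OF S]]])
  have bound: "cmod (f X) \<le> alg_norm ?C X" if X: "X \<in> carrier ?C" for X
  proof -
    obtain S where S: "S \<in> lp_operators p" "X = calkin_proj p S"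
      using X by (auto simp: calkin_carrier)
    show ?thesis
      unfolding S(2) calkin_norm f[OF S(1)]
    proof (rule cINF_greatest)
      show "calkin_proj p S \<noteq> {}" using calkin_proj_self[OF S(1)] by blast
      fix R assume R: "R \<in> calkin_proj p S"
      then have "R \<in> lp_operators p"
        using add_operator_closed[OF p compact_operator_closed[OF p] S(1)] by (auto simp: mem_calkin_proj)
      then have "cmod (g R) \<le> lp_op_norm p R" using g unfolding calkin_state_def by blast
      then show "cmod (g S) \<le> lp_op_norm p R" using inv[OF S(1) R] by simp
    qed
  qed
  have one: "f \<one>\<^bsub>?C\<^esub> = 1"
    using g f[OF one_operator_closed[OF p]] unfolding calkin_state_def calkin_one by simp
  have "f \<in> dual_space (carrier ?C) (add ?C) (Module.smult ?C) (alg_norm ?C)"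
    unfolding dual_space_def
  proof (intro CollectI conjI exI[of _ 1] ballI allI)
    fix X Y assume "X \<in> carrier ?C" "Y \<in> carrier ?C"
    then obtain S T where ST: "S \<in> lp_operators p" "X = calkin_proj p S" "T \<in> lp_operators p" "Y = calkin_proj p T"
      by (auto simp: calkin_carrier)
    show "f (X \<oplus>\<^bsub>?C\<^esub> Y) = f X + f Y"
      using g ST(1,3) unfolding ST(2,4) calkin_add[OF ST(1,3)] f[OF ST(1)] f[OF ST(3)]
        f[OF add_operator_closed[OF p ST(1,3)]] calkin_state_def by blast
  next
    fix c X assume "X \<in> carrier ?C"
    then obtain S where S: "S \<in> lp_operators p" "X = calkin_proj p S"
      by (auto simp: calkin_carrier)
    show "f (c \<odot>\<^bsub>?C\<^esub> X) = c * f X"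
      using g S(1) unfolding S(2) calkin_scale[OF S(1)] f[OF S(1)] f[OF scale_operator_closed[OF p S(1)]]
        calkin_state_def by blast
  next
    fix X assume "X \<in> carrier ?C"
    then show "cmod (f X) \<le> 1 * alg_norm ?C X" using bound by simp
  qed
  moreover have "dual_norm (carrier ?C) (alg_norm ?C) f = 1"
    unfolding dual_norm_def
  proof (rule cSup_eq_maximum)
    have "\<one>\<^bsub>?C\<^esub> \<in> {X \<in> carrier ?C. alg_norm ?C X \<le> 1}"
      using calkin_norm_le[OF one_operator_closed[OF p]] one_operator_norm_le one_operator_closed[OF p]
      by (auto simp: calkin_one calkin_carrier)
    then show "1 \<in> (\<lambda>X. cmod (f X)) ` {X \<in> carrier ?C. alg_norm ?C X \<le> 1}"
      using one by (intro image_eqI[of _ _ "\<one>\<^bsub>?C\<^esub>"]) auto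
    show "r \<le> 1" if "r \<in> (\<lambda>X. cmod (f X)) ` {X \<in> carrier ?C. alg_norm ?C X \<le> 1}" for r
      using that bound by force
  qed
  ultimately show thesis using that one f by blast
qed

lemma calkin_numerical_range:
  assumes T: "T \<in> lp_operators p"
  shows "alg_numerical_range (calkin_proj p T) (calkin_algebra p) = {g T | g. calkin_state p g}"
proof
  show "alg_numerical_range (calkin_proj p T) (calkin_algebra p) \<subseteq> {g T | g. calkin_state p g}"
  proof
    fix l assume "l \<in> alg_numerical_range (calkin_proj p T) (calkin_algebra p)"
    then obtain f where l: "l = f (calkin_proj p T)"
      and f: "f \<in> dual_space (carrier (calkin_algebra p)) (add (calkin_algebra p))
                 (Module.smult (calkin_algebra p)) (alg_norm (calkin_algebra p))"
        "dual_norm (carrier (calkin_algebra p)) (alg_norm (calkin_algebra p)) f = 1"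
        "f \<one>\<^bsub>calkin_algebra p\<^esub> = 1"
      unfolding alg_numerical_range_def mem_Collect_eq by (elim exE conjE)
    show "l \<in> {g T | g. calkin_state p g}"
      unfolding mem_Collect_eq
      by (intro exI[of _ "\<lambda>S. f (calkin_proj p S)"] conjI l calkin_state_of_functional[OF f])
  qed
  show "{g T | g. calkin_state p g} \<subseteq> alg_numerical_range (calkin_proj p T) (calkin_algebra p)"
  proof
    fix l assume "l \<in> {g T | g. calkin_state p g}"
    then obtain g where g: "calkin_state p g" and l: "l = g T" by blast
    show "l \<in> alg_numerical_range (calkin_proj p T) (calkin_algebra p)"
    proof (rule functional_of_calkin_state[OF g])
      fix f assume "f \<in> dual_space (carrier (calkin_algebra p)) (add (calkin_algebra p))
                 (Module.smult (calkin_algebra p)) (alg_norm (calkin_algebra p))"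
        "dual_norm (carrier (calkin_algebra p)) (alg_norm (calkin_algebra p)) f = 1"
        "f \<one>\<^bsub>calkin_algebra p\<^esub> = 1" and "\<And>S. S \<in> lp_operators p \<Longrightarrow> f (calkin_proj p S) = g S"
      then show ?thesis
        unfolding alg_numerical_range_def mem_Collect_eq l using T by (intro exI[of _ f]) auto
    qed
  qed
qed

end

section \<open>Lumer's estimate for states of the Calkin algebra\<close>

context
  fixes p :: real
  assumes p: "1 < p"
begin

text \<open>Lumer's estimate. If \<open>A\<close> satisfies the numerical bound, then \<open>1 - tA\<close> is bounded below by
  \<open>1 - ta\<close>; applied to the vector \<open>(1 + tA) x\<close> this controls \<open>1 + tA\<close>, because the product
  \<open>(1 - tA)(1 + tA) = 1 - t\<^sup>2A\<^sup>2\<close> differs from the identity only in second order.\<close>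

lemma lumer_estimate:
  assumes A: "A \<in> lp_operators p"
    and bound: "\<And>y. y \<in> lp p \<Longrightarrow> Re (seq_pairing (A y) (duality_map p y)) \<le> a * lp_norm p y powr p"
    and t: "0 \<le> t" "t * a < 1"
  shows "lp_op_norm p (\<one>\<^bsub>lp_operator_algebra p\<^esub> \<oplus>\<^bsub>lp_operator_algebra p\<^esub> (complex_of_real t \<odot>\<^bsub>lp_operator_algebra p\<^esub> A))
    \<le> (1 + t\<^sup>2 * (lp_op_norm p A)\<^sup>2) / (1 - t * a)"
proof (rule lp_op_norm_least[OF p])
  fix x assume x: "x \<in> lp p" "lp_norm p x \<le> 1"
  define C where "C = lp_op_norm p A"
  have C: "C \<ge> 0" unfolding C_def by (rule lp_op_norm_nonneg[OF p A])
  define y where "y = seq_add x (seq_scale t (A x))"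
  \<comment> \<open>This is \<open>(1 - tA) y\<close>, which equals \<open>x - t\<^sup>2 A (A x)\<close>.\<close>
  define w where "w = seq_add y (seq_scale (- complex_of_real t) (A y))"
  have Ax: "A x \<in> lp p" by (rule lp_operator_in_lp[OF A x(1)])
  have AAx: "A (A x) \<in> lp p" by (rule lp_operator_in_lp[OF A Ax])
  have tAx: "seq_scale t (A x) \<in> lp p" by (rule seq_scale_in_lp[OF p Ax])
  have y: "y \<in> lp p" unfolding y_def by (rule seq_add_in_lp[OF p x(1) tAx])
  have Ay: "A y \<in> lp p" by (rule lp_operator_in_lp[OF A y])
  have w: "w \<in> lp p" unfolding w_def by (intro seq_add_in_lp[OF p y] seq_scale_in_lp[OF p Ay])
  have "A y = seq_add (A x) (seq_scale t (A (A x)))"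
    unfolding y_def lp_operator_add[OF A x(1) tAx] lp_operator_scale[OF A Ax] ..
  then have w_eq: "w = seq_add x (seq_scale (- (complex_of_real t)\<^sup>2) (A (A x)))"
    by (simp add: w_def y_def fun_eq_iff algebra_simps power2_eq_square)
  have "lp_norm p (A (A x)) \<le> C * (C * lp_norm p x)"
    using lp_op_norm_bound[OF p A Ax] mult_left_mono[OF lp_op_norm_bound[OF p A x(1)] C]
    unfolding C_def by linarith
  also have "\<dots> \<le> C * (C * 1)" using C x(2) by (intro mult_left_mono) auto
  finally have AA: "lp_norm p (A (A x)) \<le> C\<^sup>2" by (simp add: power2_eq_square)
  have "lp_norm p w \<le> lp_norm p x + lp_norm p (seq_scale (- (complex_of_real t)\<^sup>2) (A (A x)))"
    unfolding w_eq by (rule lp_norm_triangle[OF p x(1) seq_scale_in_lp[OF p AAx]])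
  also have "\<dots> = lp_norm p x + t\<^sup>2 * lp_norm p (A (A x))"
    by (simp add: lp_norm_scale[OF p AAx] norm_power)
  also have "\<dots> \<le> 1 + t\<^sup>2 * C\<^sup>2"
    using x(2) AA by (intro add_mono mult_left_mono) auto
  finally have w_norm: "lp_norm p w \<le> 1 + t\<^sup>2 * C\<^sup>2" .
  have "(1 - t * a) * lp_norm p y \<le> lp_norm p w"
  proof (cases "lp_norm p y = 0")
    case False
    then have pos: "lp_norm p y > 0" using lp_norm_nonneg[of p y] by linarith
    have "seq_pairing w (duality_map p y)
        = of_real (lp_norm p y powr p) - t * seq_pairing (A y) (duality_map p y)"
      unfolding w_def pairing_add[OF p y seq_scale_in_lp[OF p Ay] y] pairing_scale[OF p Ay y]
        pairing_self[OF p y] by simp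
    then have "Re (seq_pairing w (duality_map p y))
        = lp_norm p y powr p - t * Re (seq_pairing (A y) (duality_map p y))" by simp
    moreover have "t * Re (seq_pairing (A y) (duality_map p y)) \<le> t * (a * lp_norm p y powr p)"
      by (rule mult_left_mono[OF bound[OF y] t(1)])
    ultimately have "(1 - t * a) * lp_norm p y powr p \<le> Re (seq_pairing w (duality_map p y))"
      by (simp add: algebra_simps)
    also have "\<dots> \<le> lp_norm p w * lp_norm p y powr (p - 1)"
      using complex_Re_le_cmod cmod_pairing_le[OF p w y] by (rule order_trans)
    finally have "((1 - t * a) * lp_norm p y) * lp_norm p y powr (p - 1) \<le> lp_norm p w * lp_norm p y powr (p - 1)"
      using pos powr_add[of "lp_norm p y" 1 "p - 1"] by (simp add: mult.assoc)
    then show ?thesis using pos by simp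
  qed simp
  then have "lp_norm p y \<le> (1 + t\<^sup>2 * C\<^sup>2) / (1 - t * a)"
    using w_norm t(2) by (simp add: field_simps)
  moreover have "(\<one>\<^bsub>lp_operator_algebra p\<^esub> \<oplus>\<^bsub>lp_operator_algebra p\<^esub> (complex_of_real t \<odot>\<^bsub>lp_operator_algebra p\<^esub> A)) x = y"
    using x(1) by (simp add: y_def)
  ultimately show "lp_norm p ((\<one>\<^bsub>lp_operator_algebra p\<^esub> \<oplus>\<^bsub>lp_operator_algebra p\<^esub> (complex_of_real t \<odot>\<^bsub>lp_operator_algebra p\<^esub> A)) x)
    \<le> (1 + t\<^sup>2 * (lp_op_norm p A)\<^sup>2) / (1 - t * a)"
    by (simp only: C_def)
qed

text \<open>Comparing first order terms in \<open>1 + t Re (g A) \<le> \<parallel>1 + tA\<parallel> \<le> (1 + t\<^sup>2 C\<^sup>2) / (1 - ta)\<close> as \<open>t\<close> tends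
  to zero.\<close>

lemma calkin_state_le_dissipative:
  assumes g: "calkin_state p g" and A: "A \<in> lp_operators p"
    and bound: "\<And>y. y \<in> lp p \<Longrightarrow> Re (seq_pairing (A y) (duality_map p y)) \<le> a * lp_norm p y powr p"
  shows "Re (g A) \<le> a"
proof -
  define C where "C = lp_op_norm p A"
  have step: "Re (g A) - a - t * (a * Re (g A)) - t * C\<^sup>2 \<le> 0" if t: "0 < t" "t * a < 1" for t
  proof -
    let ?B = "\<one>\<^bsub>lp_operator_algebra p\<^esub> \<oplus>\<^bsub>lp_operator_algebra p\<^esub> (complex_of_real t \<odot>\<^bsub>lp_operator_algebra p\<^esub> A)"
    note one = one_operator_closed[OF p] and tA = scale_operator_closed[OF p A, of "complex_of_real t"]
    have "g ?B = 1 + t * g A"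
      using g A one tA unfolding calkin_state_def by simp
    then have "1 + t * Re (g A) = Re (g ?B)" by simp
    also have "\<dots> \<le> cmod (g ?B)" by (rule complex_Re_le_cmod)
    also have "\<dots> \<le> lp_op_norm p ?B"
      using g add_operator_closed[OF p one tA] unfolding calkin_state_def by blast
    also have "\<dots> \<le> (1 + t\<^sup>2 * C\<^sup>2) / (1 - t * a)"
      unfolding C_def using t by (intro lumer_estimate[OF A bound]) auto
    finally have "(1 + t * Re (g A)) * (1 - t * a) \<le> 1 + t\<^sup>2 * C\<^sup>2"
      using t by (simp add: pos_le_divide_eq)
    then have "t * (Re (g A) - a - t * (a * Re (g A)) - t * C\<^sup>2) \<le> t * 0"
      by (simp add: algebra_simps power2_eq_square)
    then show ?thesis using t(1) by (simp only: mult_le_cancel_left_pos)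
  qed
  have lim: "((\<lambda>t. Re (g A) - a - t * (a * Re (g A)) - t * C\<^sup>2) \<longlongrightarrow> Re (g A) - a - 0 * (a * Re (g A)) - 0 * C\<^sup>2) (at_right 0)"
    by (intro tendsto_intros)
  have "((\<lambda>t. t * a) \<longlongrightarrow> 0 * a) (at_right (0::real))" by (intro tendsto_intros)
  then have "\<forall>\<^sub>F t in at_right 0. t * a < 1" by (rule order_tendstoD) simp
  with eventually_at_right_less[of "0::real"]
  have "\<forall>\<^sub>F t in at_right 0. Re (g A) - a - t * (a * Re (g A)) - t * C\<^sup>2 \<le> 0"
    by eventually_elim (rule step)
  from tendsto_upperbound[OF lim this] show ?thesis by simp
qed

lemma duality_map_head: "duality_map p (seq_head N x) = seq_head N (duality_map p x)"
  by (simp add: duality_map_def seq_head_def fun_eq_iff)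

text \<open>The duality map commutes with truncation, so that pairing \<open>S z\<close> with the image of a truncation of
  \<open>z\<close> gives a partial sum of \<open>\<langle>S z, J z\<rangle>\<close>. What remains, the pairing of the image of the tail, is
  small by Hoelder's inequality.\<close>

lemma pairing_head_tendsto:
  assumes S: "S \<in> lp_operators p" and z: "z \<in> lp p"
  shows "(\<lambda>M. seq_pairing (S (seq_head M z)) (duality_map p (seq_head M z)))
     \<longlonglongrightarrow> seq_pairing (S z) (duality_map p z)"
proof -
  note head = head_tail_in_lp[OF p z]
  have Sz: "S z \<in> lp p" by (rule lp_operator_in_lp[OF S z])
  have "seq_pairing (S z) (duality_map p (seq_head M z)) = (\<Sum>j<M. S z j * cnj (duality_map p z j))" for M
    unfolding seq_pairing_def duality_map_head
    by (subst suminf_finite[of "{..<M}"]) (auto simp: seq_head_def)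
  then have main: "(\<lambda>M. seq_pairing (S z) (duality_map p (seq_head M z))) \<longlonglongrightarrow> seq_pairing (S z) (duality_map p z)"
    using summable_LIMSEQ[OF summable_pairing[OF p Sz z]] by (simp add: seq_pairing_def)
  have split: "seq_pairing (S z) (duality_map p (seq_head M z))
      = seq_pairing (S (seq_head M z)) (duality_map p (seq_head M z))
        + seq_pairing (S (seq_tail M z)) (duality_map p (seq_head M z))" for M
    using pairing_add[OF p lp_operator_in_lp[OF S head(1)] lp_operator_in_lp[OF S head(2)] head(1), of M M M]
      lp_operator_add[OF S head(1,2), of M M]
    by (simp add: head_add_tail)
  have "(\<lambda>M. seq_pairing (S (seq_tail M z)) (duality_map p (seq_head M z))) \<longlonglongrightarrow> 0"
  proof (rule Lim_null_comparison[OF always_eventually], intro allI)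
    fix M
    have "cmod (seq_pairing (S (seq_tail M z)) (duality_map p (seq_head M z)))
        \<le> lp_norm p (S (seq_tail M z)) * lp_norm p (seq_head M z) powr (p - 1)"
      by (rule cmod_pairing_le[OF p lp_operator_in_lp[OF S head(2)] head(1)])
    also have "\<dots> \<le> (lp_op_norm p S * lp_norm p (seq_tail M z)) * lp_norm p z powr (p - 1)"
      using p head(3) lp_op_norm_nonneg[OF p S]
      by (intro mult_mono lp_op_norm_bound[OF p S head(2)] powr_mono2) auto
    finally show "norm (seq_pairing (S (seq_tail M z)) (duality_map p (seq_head M z)))
        \<le> (lp_op_norm p S * lp_norm p (seq_tail M z)) * lp_norm p z powr (p - 1)" .
    show "(\<lambda>M. (lp_op_norm p S * lp_norm p (seq_tail M z)) * lp_norm p z powr (p - 1)) \<longlonglongrightarrow> 0"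
      by (intro tendsto_mult_left_zero tendsto_mult_right_zero lp_norm_tail_tendsto_0[OF p z])
  qed
  from tendsto_diff[OF main this] show ?thesis by (simp add: split)
qed

text \<open>This is the case of the identity operator, since \<open>\<langle>z, J z\<rangle>\<close> is the \<open>p\<close>-th power of the norm.\<close>

lemma norm_head_tendsto:
  assumes z: "z \<in> lp p"
  shows "(\<lambda>M. lp_norm p (seq_head M z) powr p) \<longlonglongrightarrow> lp_norm p z powr p"
proof -
  have "(\<lambda>M. Re (seq_pairing (seq_head M z) (duality_map p (seq_head M z)))) \<longlonglongrightarrow> Re (seq_pairing z (duality_map p z))"
    using pairing_head_tendsto[OF one_operator_closed[OF p] z] head_tail_in_lp(1)[OF p z] z
    by (intro tendsto_Re) simp
  then show ?thesis by (simp add: pairing_self[OF p] head_tail_in_lp(1)[OF p z] z)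
qed

text \<open>A bound on the numerical values at vectors that live far out is a bound on every state of the
  Calkin algebra. With \<open>P\<close> the projection on the first \<open>N\<close> coordinates and \<open>Q = 1 - P\<close>, the operator
  \<open>Q S Q + a P\<close> is a compact perturbation of \<open>S\<close> for which the bound holds at all vectors, since the
  duality map respects the decomposition into \<open>P y\<close> and \<open>Q y\<close>.\<close>

lemma calkin_state_le:
  assumes g: "calkin_state p g" and S: "S \<in> lp_operators p"
    and bound: "\<And>M y. y \<in> block N M \<Longrightarrow> Re (seq_pairing (S y) (duality_map p y)) \<le> a * lp_norm p y powr p"
  shows "Re (g S) \<le> a"
proof -
  let ?A = "lp_operator_algebra p"
  define P where "P = head_operator p N"
  have P: "P \<in> lp_operators p" "P \<in> lp_compact_operators p"
    unfolding P_def by (rule head_operator_closed[OF p], rule head_operator_compact[OF p])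
  have Papp: "P x = seq_head N x" if "x \<in> lp p" for x
    using that by (simp add: P_def)
  \<comment> \<open>With \<open>Q = 1 - P\<close>, the operator \<open>S + K\<close> is \<open>Q S Q + a P\<close>.\<close>
  define K where "K = (complex_of_real a \<odot>\<^bsub>?A\<^esub> P) \<oplus>\<^bsub>?A\<^esub>
     (((-1) \<odot>\<^bsub>?A\<^esub> (P \<otimes>\<^bsub>?A\<^esub> S)) \<oplus>\<^bsub>?A\<^esub> (((-1) \<odot>\<^bsub>?A\<^esub> (S \<otimes>\<^bsub>?A\<^esub> P)) \<oplus>\<^bsub>?A\<^esub> (P \<otimes>\<^bsub>?A\<^esub> (S \<otimes>\<^bsub>?A\<^esub> P))))"
  have SP: "S \<otimes>\<^bsub>?A\<^esub> P \<in> lp_compact_operators p" by (rule compact_operator_mult_left[OF p S P(2)])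
  have K: "K \<in> lp_compact_operators p"
    unfolding K_def
    by (intro compact_operator_add[OF p] compact_operator_scale[OF p] P(2) SP
        compact_operator_mult_left[OF p P(1)] compact_operator_mult_right[OF p S])
  have A: "S \<oplus>\<^bsub>?A\<^esub> K \<in> lp_operators p"
    by (rule add_operator_closed[OF p S compact_operator_closed[OF p K]])
  have SK: "(S \<oplus>\<^bsub>?A\<^esub> K) y j = (if j < N then complex_of_real a * y j else S (seq_tail N y) j)"
    if y: "y \<in> lp p" for y j
  proof -
    note head = head_tail_in_lp(1,2)[OF p y]
    have "S y = seq_add (S (seq_head N y)) (S (seq_tail N y))"
      using lp_operator_add[OF S head, of N N] by (simp add: head_add_tail)
    then have "S y j = S (seq_head N y) j + S (seq_tail N y) j" by simp
    then show ?thesis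
      using y by (simp add: K_def Papp head lp_operator_in_lp[OF S]) (simp add: seq_head_def)
  qed
  have tail: "Re (seq_pairing (S (seq_tail N y)) (duality_map p (seq_tail N y)))
      \<le> a * lp_norm p (seq_tail N y) powr p" if y: "y \<in> lp p" for y
  proof -
    note z = head_tail_in_lp(2)[OF p y, of N]
    show ?thesis
    proof (rule tendsto_le[OF _ _ tendsto_Re[OF pairing_head_tendsto[OF S z]]])
      show "(\<lambda>M. a * lp_norm p (seq_head M (seq_tail N y)) powr p) \<longlonglongrightarrow> a * lp_norm p (seq_tail N y) powr p"
        by (intro tendsto_mult_left norm_head_tendsto z)
    qed (simp_all add: bound[OF head_tail_block])
  qed
  have "Re (seq_pairing ((S \<oplus>\<^bsub>?A\<^esub> K) y) (duality_map p y)) \<le> a * lp_norm p y powr p" if y: "y \<in> lp p" for y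
  proof -
    note head = head_tail_in_lp(1,2)[OF p y, of N]
    have "(S \<oplus>\<^bsub>?A\<^esub> K) y j * cnj (duality_map p y j)
       = S (seq_tail N y) j * cnj (duality_map p (seq_tail N y) j)
         + a * (seq_head N y j * cnj (duality_map p (seq_head N y) j))" for j
      unfolding SK[OF y] by (simp add: duality_map_def seq_head_def seq_tail_def)
    then have "seq_pairing ((S \<oplus>\<^bsub>?A\<^esub> K) y) (duality_map p y)
       = seq_pairing (S (seq_tail N y)) (duality_map p (seq_tail N y))
         + a * seq_pairing (seq_head N y) (duality_map p (seq_head N y))"
      using suminf_add[OF summable_pairing[OF p lp_operator_in_lp[OF S head(2)] head(2)]
          summable_mult[OF summable_pairing[OF p head(1) head(1)], of "complex_of_real a"]]
        suminf_mult[OF summable_pairing[OF p head(1) head(1)], of "complex_of_real a"]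
      by (simp add: seq_pairing_def)
    then have "Re (seq_pairing ((S \<oplus>\<^bsub>?A\<^esub> K) y) (duality_map p y))
       = Re (seq_pairing (S (seq_tail N y)) (duality_map p (seq_tail N y))) + a * lp_norm p (seq_head N y) powr p"
      by (simp add: pairing_self[OF p head(1)])
    moreover have "lp_norm p y powr p = lp_norm p (seq_head N y) powr p + lp_norm p (seq_tail N y) powr p"
      using lp_norm_disjoint_add[OF p head] unfolding head_add_tail
      by (simp add: seq_head_def seq_tail_def)
    ultimately show ?thesis using tail[OF y] by (simp add: distrib_left)
  qed
  from calkin_state_le_dissipative[OF g A this] have "Re (g (S \<oplus>\<^bsub>?A\<^esub> K)) \<le> a" by blast
  moreover have "g (S \<oplus>\<^bsub>?A\<^esub> K) = g S"
    using g S K compact_operator_closed[OF p K] unfolding calkin_state_def by simp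
  ultimately show ?thesis by simp
qed

end

section \<open>Numerical values at vectors that live far out\<close>

definition tail_values :: "real \<Rightarrow> ((nat \<Rightarrow> complex) \<Rightarrow> (nat \<Rightarrow> complex)) \<Rightarrow> nat \<Rightarrow> complex set" where
  "tail_values p T N =
     {seq_pairing (T x) (duality_map p x) | x M. x \<in> block N M \<and> lp_norm p x = 1}"

lemma block_antimono: "M \<le> N \<Longrightarrow> block N L \<subseteq> block M L"
  by (auto simp: block_def)

lemma tail_values_antimono: "M \<le> N \<Longrightarrow> tail_values p T N \<subseteq> tail_values p T M"
  using block_antimono unfolding tail_values_def by blast

lemma pairing_scale_right:
  assumes "summable (\<lambda>j. u j * cnj (v j))"
  shows "seq_pairing u (seq_scale c v) = cnj c * seq_pairing u v"
  using suminf_mult[OF assms, of "cnj c"] by (simp add: seq_pairing_def mult_ac)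

lemma duality_map_scale:
  assumes "c > 0"
  shows "duality_map p (seq_scale (complex_of_real c) x) = seq_scale (complex_of_real (c powr (p - 1))) (duality_map p x)"
  using assms powr_add[of c 1 "p - 2"]
  by (simp add: duality_map_def fun_eq_iff norm_mult powr_mult mult_ac)

lemma duality_map_disjoint_add:
  assumes "\<And>j. x j = 0 \<or> y j = 0"
  shows "duality_map p (seq_add x y) = seq_add (duality_map p x) (duality_map p y)"
proof
  show "duality_map p (seq_add x y) j = seq_add (duality_map p x) (duality_map p y) j" for j
    using assms[of j] by (auto simp: duality_map_def)
qed

context
  fixes p :: real
  assumes p: "1 < p"
begin

text \<open>Choose for every \<open>n\<close> a vector beyond \<open>n\<close> whose value is within \<open>1 / (n + 1)\<close> of the given number;
  since the supports escape to infinity, the sequence is weakly null.\<close>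

lemma essential_numerical_range_superset:
  "(\<Inter>N. closure (tail_values p T N)) \<subseteq> essential_numerical_range p T"
proof
  fix l assume l: "l \<in> (\<Inter>N. closure (tail_values p T N))"
  have "\<exists>x. (\<exists>M. x \<in> block n M) \<and> lp_norm p x = 1 \<and>
      dist (seq_pairing (T x) (duality_map p x)) l < inverse (real (Suc n))" for n
  proof -
    have "l \<in> closure (tail_values p T n)" "inverse (real (Suc n)) > 0" using l by auto
    then obtain w where "w \<in> tail_values p T n" "dist w l < inverse (real (Suc n))"
      unfolding closure_approachable by blast
    then show ?thesis unfolding tail_values_def by blast
  qed
  then have "\<exists>x. \<forall>n. (\<exists>M. x n \<in> block n M) \<and> lp_norm p (x n) = 1 \<and>
      dist (seq_pairing (T (x n)) (duality_map p (x n))) l < inverse (real (Suc n))"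
    by (intro choice allI)
  then obtain x where x: "\<And>n. \<exists>M. x n \<in> block n M" "\<And>n. lp_norm p (x n) = 1"
    "\<And>n. dist (seq_pairing (T (x n)) (duality_map p (x n))) l < inverse (real (Suc n))"
    by blast
  have "(\<lambda>n. seq_pairing (T (x n)) (duality_map p (x n))) \<longlonglongrightarrow> l"
  proof (rule metric_LIMSEQ_I)
    fix r :: real assume "r > 0"
    then obtain n0 where n0: "inverse (real (Suc n0)) < r" using reals_Archimedean by blast
    show "\<exists>n0. \<forall>n\<ge>n0. dist (seq_pairing (T (x n)) (duality_map p (x n))) l < r"
    proof (intro exI[of _ n0] allI impI)
      fix n assume "n0 \<le> n"
      then have "inverse (real (Suc n)) \<le> inverse (real (Suc n0))" by (intro le_imp_inverse_le) auto
      then show "dist (seq_pairing (T (x n)) (duality_map p (x n))) l < r"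
        using x(3)[of n] n0 by linarith
    qed
  qed
  moreover have "lp_weakly_null p x"
    by (rule weakly_null_of_escaping_support[OF p x(1)]) (simp add: x(2))
  moreover have "x n \<in> lp p" for n
    using x(1)[of n] by (elim exE) (rule block_in_lp[OF p])
  ultimately show "l \<in> essential_numerical_range p T"
    unfolding essential_numerical_range_def mem_Collect_eq using x(2) by (intro exI[of _ x] conjI allI)
qed

text \<open>Given approximate values at \<open>x\<close> and at \<open>y\<close>, the unit vector \<open>s\<^sup>1\<^sup>/\<^sup>p x + t\<^sup>1\<^sup>/\<^sup>p y\<close> attains
  approximately their convex combination, provided that \<open>y\<close> lives beyond the support of \<open>x\<close> and so far
  out that the mixed terms are negligible: \<open>T x\<close> has a small tail, and \<open>y \<mapsto> \<langle>T y, J x\<rangle>\<close> is a bounded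
  functional.\<close>

lemma tail_values_convex:
  assumes T: "T \<in> lp_operators p"
    and l: "l \<in> (\<Inter>N. closure (tail_values p T N))" and m: "m \<in> (\<Inter>N. closure (tail_values p T N))"
    and t: "0 < s" "0 < t" "s + t = 1"
  shows "of_real s * l + of_real t * m \<in> (\<Inter>N. closure (tail_values p T N))"
proof
  fix N
  show "of_real s * l + of_real t * m \<in> closure (tail_values p T N)"
    unfolding closure_approachable
  proof (intro allI impI)
    fix e :: real assume e: "e > 0"
    define d where "d = e / 4"
    have d: "d > 0" using e by (simp add: d_def)
    have "l \<in> closure (tail_values p T N)" using l by blast
    then obtain x M where x: "x \<in> block N M" "lp_norm p x = 1"
        "dist (seq_pairing (T x) (duality_map p x)) l < d"
      using d unfolding closure_approachable tail_values_def by blast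
    have xl: "x \<in> lp p" by (rule block_in_lp[OF p x(1)])
    have Tx: "T x \<in> lp p" by (rule lp_operator_in_lp[OF T xl])
    have "\<forall>\<^sub>F M' in sequentially. lp_norm p (seq_tail M' (T x)) < d"
      using order_tendstoD(2)[OF lp_norm_tail_tendsto_0[OF p Tx] d] .
    then obtain M1 where M1: "\<And>M'. M' \<ge> M1 \<Longrightarrow> lp_norm p (seq_tail M' (T x)) < d"
      unfolding eventually_sequentially by blast
    obtain M2 where M2: "\<And>N y. y \<in> block M2 N \<Longrightarrow> lp_norm p y \<le> 1 \<Longrightarrow> cmod (seq_pairing (T y) (duality_map p x)) \<le> d"
      using functional_small_on_tails[OF p pairing_functional[OF p T xl] d] by blast
    define M' where "M' = Max {N, M, M1, M2}"
    have M': "N \<le> M'" "M \<le> M'" "M1 \<le> M'" "M2 \<le> M'" by (simp_all add: M'_def)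
    have "m \<in> closure (tail_values p T M')" using m by blast
    then obtain y L where y: "y \<in> block M' L" "lp_norm p y = 1"
        "dist (seq_pairing (T y) (duality_map p y)) m < d"
      using d unfolding closure_approachable tail_values_def by blast
    have yl: "y \<in> lp p" by (rule block_in_lp[OF p y(1)])
    have Ty: "T y \<in> lp p" by (rule lp_operator_in_lp[OF T yl])
    have disj: "x j = 0 \<or> y j = 0" for j
      using x(1) y(1) M'(2) unfolding block_def by (cases "j < M") force+
    have yx: "cmod (seq_pairing (T y) (duality_map p x)) \<le> d"
    proof (rule M2)
      show "y \<in> block M2 L" using y(1) M'(4) by (auto simp: block_def)
    qed (simp add: y(2))
    have xy: "cmod (seq_pairing (T x) (duality_map p y)) \<le> d"
    proof -
      have "T x j * cnj (duality_map p y j) = seq_tail M' (T x) j * cnj (duality_map p y j)" for j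
        using y(1) by (auto simp: seq_tail_def block_def duality_map_def)
      then have "seq_pairing (T x) (duality_map p y) = seq_pairing (seq_tail M' (T x)) (duality_map p y)"
        by (simp only: seq_pairing_def)
      then show ?thesis
        using cmod_pairing_le[OF p head_tail_in_lp(2)[OF p Tx] yl, of M'] M1[OF M'(3)] y(2) by simp
    qed
    \<comment> \<open>The weights for which \<open>a\<^sup>p + b\<^sup>p = 1\<close>, while \<open>J\<close> turns a factor \<open>a\<close> into \<open>a\<^sup>p / a\<close>.\<close>
    define a b where "a = s powr (1 / p)" and "b = t powr (1 / p)"
    have ab: "a > 0" "b > 0" "a \<le> 1" "b \<le> 1"
      using t p by (auto simp: a_def b_def powr_le1)
    have ap: "a powr p = s" "b powr p = t"
      using t p by (auto simp: a_def b_def powr_powr)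
    have aq: "a * a powr (p - 1) = s" "b * b powr (p - 1) = t"
      using powr_add[of a 1 "p - 1"] powr_add[of b 1 "p - 1"] ab ap by simp_all
    have q1: "a powr (p - 1) \<le> 1" "b powr (p - 1) \<le> 1"
      using ab p by (auto intro!: powr_le1)
    define x' y' where "x' = seq_scale (complex_of_real a) x" and "y' = seq_scale (complex_of_real b) y"
    have l': "x' \<in> lp p" "y' \<in> lp p" unfolding x'_def y'_def by (intro seq_scale_in_lp[OF p] xl yl)+
    have disj': "x' j = 0 \<or> y' j = 0" for j using disj[of j] by (auto simp: x'_def y'_def)
    have n': "lp_norm p x' = a" "lp_norm p y' = b"
      unfolding x'_def y'_def lp_norm_scale[OF p xl] lp_norm_scale[OF p yl] using ab x(2) y(2) by simp_all
    have "lp_norm p (seq_add x' y') powr p = 1"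
      unfolding lp_norm_disjoint_add[OF p l' disj'] n' ap by (rule t(3))
    then have norm: "lp_norm p (seq_add x' y') = 1"
      using p powr_one_eq_one[of "1/p"] powr_powr[of "lp_norm p (seq_add x' y')" p "1/p"] by simp
    have "x' \<in> block N M'" using x(1) M'(2) by (auto simp: block_def x'_def)
    moreover have "y' \<in> block M' (max M' L)" using y(1) by (auto simp: block_def y'_def)
    ultimately have "seq_add x' y' \<in> block N (max M' L)"
      using M'(1) by (intro block_add[of _ _ M']) simp_all
    then have mem: "seq_pairing (T (seq_add x' y')) (duality_map p (seq_add x' y')) \<in> tail_values p T N"
      using norm unfolding tail_values_def by blast
    have J: "duality_map p (seq_add x' y')
        = seq_add (seq_scale (a powr (p - 1)) (duality_map p x)) (seq_scale (b powr (p - 1)) (duality_map p y))"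
      unfolding duality_map_disjoint_add[of x' y', OF disj']
      unfolding x'_def y'_def duality_map_scale[OF ab(1)] duality_map_scale[OF ab(2)] ..
    have pair: "seq_pairing u (duality_map p (seq_add x' y'))
       = a powr (p - 1) * seq_pairing u (duality_map p x) + b powr (p - 1) * seq_pairing u (duality_map p y)"
      if u: "u \<in> lp p" for u
    proof -
      note sx = summable_pairing[OF p u xl] and sy = summable_pairing[OF p u yl]
      have "seq_pairing u (duality_map p (seq_add x' y'))
        = seq_pairing u (seq_scale (a powr (p - 1)) (duality_map p x))
          + seq_pairing u (seq_scale (b powr (p - 1)) (duality_map p y))"
        unfolding J seq_pairing_def
        using suminf_add[OF summable_mult[OF sx, of "a powr (p - 1)"] summable_mult[OF sy, of "b powr (p - 1)"]]
        by (simp add: distrib_left mult_ac)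
      then show ?thesis by (simp add: pairing_scale_right[OF sx] pairing_scale_right[OF sy])
    qed
    have "T (seq_add x' y') = seq_add (seq_scale (complex_of_real a) (T x)) (seq_scale (complex_of_real b) (T y))"
      unfolding lp_operator_add[OF T l'] unfolding x'_def y'_def lp_operator_scale[OF T xl] lp_operator_scale[OF T yl] ..
    then have "seq_pairing (T (seq_add x' y')) (duality_map p (seq_add x' y'))
       = a * seq_pairing (T x) (duality_map p (seq_add x' y')) + b * seq_pairing (T y) (duality_map p (seq_add x' y'))"
      using pairing_add[OF p seq_scale_in_lp[OF p Tx] seq_scale_in_lp[OF p Ty] seq_add_in_lp[OF p l']]
        pairing_scale[OF p Tx seq_add_in_lp[OF p l']] pairing_scale[OF p Ty seq_add_in_lp[OF p l']] by simp
    also have "\<dots> = of_real (a * a powr (p - 1)) * seq_pairing (T x) (duality_map p x)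
        + of_real (b * b powr (p - 1)) * seq_pairing (T y) (duality_map p y)
        + (of_real (a * b powr (p - 1)) * seq_pairing (T x) (duality_map p y)
        + of_real (b * a powr (p - 1)) * seq_pairing (T y) (duality_map p x))"
      unfolding pair[OF Tx] pair[OF Ty] by (simp add: algebra_simps)
    finally have eq: "seq_pairing (T (seq_add x' y')) (duality_map p (seq_add x' y')) - (of_real s * l + of_real t * m)
       = of_real s * (seq_pairing (T x) (duality_map p x) - l)
        + of_real t * (seq_pairing (T y) (duality_map p y) - m)
        + (of_real (a * b powr (p - 1)) * seq_pairing (T x) (duality_map p y)
        + of_real (b * a powr (p - 1)) * seq_pairing (T y) (duality_map p x))"
      unfolding aq by (simp add: algebra_simps)
    have small: "cmod (of_real r * z) \<le> d" if "0 \<le> r" "r \<le> 1" "cmod z \<le> d" for r z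
      using mult_mono[of r 1 "cmod z" d] that by (simp add: norm_mult)
    have coeff: "0 \<le> a * b powr (p - 1)" "a * b powr (p - 1) \<le> 1" "0 \<le> b * a powr (p - 1)" "b * a powr (p - 1) \<le> 1"
      using ab q1 mult_mono[of a 1 "b powr (p - 1)" 1] mult_mono[of b 1 "a powr (p - 1)" 1] by auto
    have "cmod (of_real s * (seq_pairing (T x) (duality_map p x) - l)) < d"
    proof -
      have "s * cmod (seq_pairing (T x) (duality_map p x) - l) \<le> 1 * cmod (seq_pairing (T x) (duality_map p x) - l)"
        using t by (intro mult_right_mono) auto
      then show ?thesis using x(3) t by (simp add: norm_mult dist_norm)
    qed
    moreover have "cmod (of_real t * (seq_pairing (T y) (duality_map p y) - m)) \<le> d"
      using y(3) t by (intro small) (auto simp: dist_norm)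
    moreover note small[OF coeff(1,2) xy] small[OF coeff(3,4) yx]
    moreover have "cmod (z1 + z2 + (z3 + z4)) \<le> cmod z1 + cmod z2 + (cmod z3 + cmod z4)" for z1 z2 z3 z4
      by (intro norm_triangle_mono order_refl)
    ultimately have "dist (seq_pairing (T (seq_add x' y')) (duality_map p (seq_add x' y'))) (of_real s * l + of_real t * m) < 4 * d"
      unfolding dist_norm eq by (smt (verit))
    then show "\<exists>w\<in>tail_values p T N. dist w (of_real s * l + of_real t * m) < e"
      using mem by (auto simp: d_def)
  qed
qed

lemma bounded_tail_values:
  assumes T: "T \<in> lp_operators p"
  shows "bounded (tail_values p T N)"
proof (rule boundedI)
  fix w assume "w \<in> tail_values p T N"
  then show "norm w \<le> lp_op_norm p T"
    unfolding tail_values_def using pairing_operator_bound[OF p T block_in_lp[OF p]] by blast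
qed

text \<open>If the value of a state were outside the closed convex set of limits of values at far vectors, a
  line would separate the two. By compactness the line separates already the closure of one of the
  sets \<open>tail_values p T N\<close> from the value of the state, against the bound for states.\<close>

lemma calkin_state_in_tail_values:
  assumes g: "calkin_state p g" and T: "T \<in> lp_operators p"
  shows "g T \<in> (\<Inter>N. closure (tail_values p T N))"
proof (rule ccontr)
  let ?W = "\<Inter>N. closure (tail_values p T N)"
  assume outside: "g T \<notin> ?W"
  have convex: "convex ?W"
    unfolding convex_alt
  proof (intro ballI allI impI)
    fix l m and t :: real assume lm: "l \<in> ?W" "m \<in> ?W" and t: "0 \<le> t \<and> t \<le> 1"
    show "(1 - t) *\<^sub>R l + t *\<^sub>R m \<in> ?W"
    proof (cases "t = 0 \<or> t = 1")
      case False
      then show ?thesis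
        using tail_values_convex[OF T lm, of "1 - t" t] t by (simp only: scaleR_conv_of_real) simp
    qed (use lm in auto)
  qed
  have "closed ?W" by (intro closed_INT) simp
  from separating_hyperplane_closed_point[OF convex this outside] obtain a b where ab: "inner a (g T) < b" "\<And>w. w \<in> ?W \<Longrightarrow> inner a w > b"
    by blast
  define F where "F N = closure (tail_values p T N) \<inter> {w. inner a w \<le> b}" for N
  have "\<exists>N. F N = {}"
  proof (rule ccontr)
    assume "\<not> ?thesis"
    have "\<Inter>(range F) \<noteq> {}"
    proof (rule compact_nest)
      show "compact (F n)" for n
        unfolding F_def
        by (intro compact_Int_closed closed_halfspace_le) (simp add: compact_closure bounded_tail_values[OF T])
      show "F n \<noteq> {}" for n using \<open>\<not> (\<exists>N. F N = {})\<close> by blast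
      show "F n \<subseteq> F m" if "m \<le> n" for m n
        unfolding F_def by (intro Int_mono order_refl closure_mono tail_values_antimono that)
    qed
    then obtain w where w: "\<And>N. w \<in> F N" by blast
    then have "w \<in> ?W" and "inner a w \<le> b" by (auto simp: F_def)
    then show False using ab(2) by force
  qed
  then obtain N where N: "F N = {}" by blast
  \<comment> \<open>Rotate and scale so that the separating line becomes a bound on real parts.\<close>
  define c where "c = - cnj a"
  have Re_c: "Re (c * z) = - inner a z" for z by (simp add: c_def inner_complex_def)
  define S where "S = c \<odot>\<^bsub>lp_operator_algebra p\<^esub> T"
  have S: "S \<in> lp_operators p" unfolding S_def by (rule scale_operator_closed[OF p T])
  have "Re (seq_pairing (S y) (duality_map p y)) \<le> - b * lp_norm p y powr p" if y: "y \<in> block N M" for M y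
  proof (cases "lp_norm p y = 0")
    case True
    then have "y = (\<lambda>j. 0)" using lp_norm_eq_0_iff[OF p block_in_lp[OF p y]] by blast
    then show ?thesis using p by (simp add: seq_pairing_def duality_map_def lp_norm_zero)
  next
    case False
    define r where "r = lp_norm p y"
    have r: "r > 0" using False lp_norm_nonneg[of p y] unfolding r_def by linarith
    define x where "x = seq_scale (complex_of_real (1 / r)) y"
    have x: "x \<in> block N M" unfolding x_def by (rule block_scale[OF y])
    have xl: "x \<in> lp p" by (rule block_in_lp[OF p x])
    have nx: "lp_norm p x = 1"
      unfolding x_def lp_norm_scale_block[OF p y] using r by (simp add: norm_divide r_def)
    have yx: "y = seq_scale (complex_of_real r) x" using r by (simp add: x_def fun_eq_iff)
    have "seq_pairing (T x) (duality_map p x) \<in> closure (tail_values p T N)"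
      using x nx by (intro subsetD[OF closure_subset]) (auto simp: tail_values_def)
    then have val: "inner a (seq_pairing (T x) (duality_map p x)) > b"
      using N by (force simp: F_def)
    have Tx: "T x \<in> lp p" by (rule lp_operator_in_lp[OF T xl])
    have "S y = seq_scale (c * complex_of_real r) (T x)"
      using block_in_lp[OF p y] lp_operator_scale[OF T xl, of "complex_of_real r"]
      by (simp add: S_def fun_eq_iff flip: yx)
    moreover have "duality_map p y = seq_scale (complex_of_real (r powr (p - 1))) (duality_map p x)"
      unfolding yx by (rule duality_map_scale[OF r])
    ultimately have "seq_pairing (S y) (duality_map p y)
        = of_real (r powr (p - 1)) * ((c * of_real r) * seq_pairing (T x) (duality_map p x))"
      using pairing_scale_right[OF summable_pairing[OF p seq_scale_in_lp[OF p Tx] xl]]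
      by (simp only: pairing_scale[OF p Tx xl] complex_cnj_complex_of_real)
    also have "\<dots> = of_real (r * r powr (p - 1)) * (c * seq_pairing (T x) (duality_map p x))"
      by simp
    also have "r * r powr (p - 1) = r powr p"
      using r powr_add[of r 1 "p - 1"] by simp
    finally have "Re (seq_pairing (S y) (duality_map p y)) = r powr p * (- inner a (seq_pairing (T x) (duality_map p x)))"
      by (simp only: Re_complex_of_real Im_complex_of_real times_complex.simps(1) mult_zero_left diff_zero Re_c[symmetric])
    also have "\<dots> \<le> r powr p * (- b)"
      using val by (intro mult_left_mono) auto
    finally show ?thesis by (simp add: r_def mult.commute)
  qed
  then have "Re (g S) \<le> - b" by (rule calkin_state_le[OF p g S])
  moreover have "g S = c * g T" using g T unfolding calkin_state_def S_def by blast
  ultimately show False using ab(1) Re_c by simp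
qed

end

section \<open>States from weakly null sequences\<close>

context
  fixes p :: real
  assumes p: "1 < p"
begin

text \<open>The functionals \<open>S \<mapsto> \<langle>S x\<^sub>n, J(x\<^sub>n)\<rangle>\<close> lie in a product of discs, which is compact, so they have a
  pointwise cluster point. Every identity that holds along the sequence passes to it.\<close>

lemma calkin_state_of_weakly_null:
  assumes x: "\<And>n. x n \<in> lp p" "\<And>n. lp_norm p (x n) = 1" and null: "lp_weakly_null p x"
    and T: "T \<in> lp_operators p"
    and lim: "(\<lambda>n. seq_pairing (T (x n)) (duality_map p (x n))) \<longlonglongrightarrow> l"
  obtains g where "calkin_state p g" and "g T = l"
proof -
  let ?A = "lp_operator_algebra p"
  define \<Phi> where "\<Phi> n S = (if S \<in> lp_operators p then seq_pairing (S (x n)) (duality_map p (x n)) else 0)" for n S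
  have \<Phi>: "\<Phi> n S = seq_pairing (S (x n)) (duality_map p (x n))" if "S \<in> lp_operators p" for n S
    using that by (simp add: \<Phi>_def)
  define B where "B S = (if S \<in> lp_operators p then lp_op_norm p S else 0)" for S
  define D where "D = (\<Pi>\<^sub>E S\<in>UNIV. cball (0::complex) (B S))"
  have "compact D"
  proof -
    have "compactin (product_topology (\<lambda>_. euclidean) UNIV) D"
      unfolding D_def compactin_PiE by simp
    then show ?thesis by (simp add: euclidean_product_topology)
  qed
  have \<Phi>D: "\<Phi> n \<in> D" for n
    using pairing_operator_bound[OF p _ x(1,2)] by (auto simp: D_def \<Phi>_def B_def PiE_def)
  let ?F = "filtermap \<Phi> sequentially"
  have "?F \<noteq> bot" by (simp add: filtermap_bot_iff)
  moreover have "eventually (\<lambda>\<phi>. \<phi> \<in> D) ?F" using \<Phi>D by (simp add: eventually_filtermap)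
  ultimately obtain g where g: "g \<in> D" "inf (nhds g) ?F \<noteq> bot"
    using \<open>compact D\<close> unfolding compact_filter by blast
  \<comment> \<open>A continuous quantity that converges along the sequence takes its limit at the cluster point.\<close>
  have passes: "h g = c" if h: "(h \<longlongrightarrow> h g) (nhds g)" and c: "(\<lambda>n. h (\<Phi> n)) \<longlonglongrightarrow> c"
    for h :: "_ \<Rightarrow> complex" and c
  proof (rule tendsto_unique[OF g(2)])
    show "(h \<longlongrightarrow> h g) (inf (nhds g) ?F)" using h by (rule tendsto_mono[rotated]) simp
    have "(h \<longlongrightarrow> c) ?F" using c by (simp add: filterlim_filtermap)
    then show "(h \<longlongrightarrow> c) (inf (nhds g) ?F)" by (rule tendsto_mono[rotated]) simp
  qed
  have ev: "((\<lambda>\<phi>. \<phi> S) \<longlongrightarrow> g S) (nhds g)" for S :: "(nat \<Rightarrow> complex) \<Rightarrow> nat \<Rightarrow> complex"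
  proof -
    have "continuous_on UNIV (\<lambda>\<phi> :: _ \<Rightarrow> complex. \<phi> S)" by (rule continuous_on_product_coordinates)
    then have "((\<lambda>\<phi>. \<phi> S) \<longlongrightarrow> g S) (at g)" unfolding continuous_on_def by blast
    then show ?thesis by (rule tendsto_at_iff_tendsto_nhds[THEN iffD1])
  qed
  have value_eq: "g S = c" if "(\<lambda>n. \<Phi> n S) \<longlonglongrightarrow> c" for S c
    by (rule passes[of "\<lambda>\<phi>. \<phi> S", OF ev that])
  have "calkin_state p g"
    unfolding calkin_state_def
  proof (intro conjI ballI allI)
    fix S R assume S: "S \<in> lp_operators p" and R: "R \<in> lp_operators p"
    have "g (S \<oplus>\<^bsub>?A\<^esub> R) - (g S + g R) = 0"
    proof (rule passes[of "\<lambda>\<phi>. \<phi> (S \<oplus>\<^bsub>?A\<^esub> R) - (\<phi> S + \<phi> R)"])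
      show "((\<lambda>\<phi>. \<phi> (S \<oplus>\<^bsub>?A\<^esub> R) - (\<phi> S + \<phi> R)) \<longlongrightarrow> g (S \<oplus>\<^bsub>?A\<^esub> R) - (g S + g R)) (nhds g)"
        by (intro tendsto_diff tendsto_add ev)
      show "(\<lambda>n. \<Phi> n (S \<oplus>\<^bsub>?A\<^esub> R) - (\<Phi> n S + \<Phi> n R)) \<longlonglongrightarrow> 0"
        by (simp add: \<Phi>[OF S] \<Phi>[OF R] \<Phi>[OF add_operator_closed[OF p S R]] x(1)
            pairing_add[OF p lp_operator_in_lp[OF S] lp_operator_in_lp[OF R]])
    qed
    then show "g (S \<oplus>\<^bsub>?A\<^esub> R) = g S + g R" by simp
  next
    fix c S assume S: "S \<in> lp_operators p"
    have "g (c \<odot>\<^bsub>?A\<^esub> S) - c * g S = 0"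
    proof (rule passes[of "\<lambda>\<phi>. \<phi> (c \<odot>\<^bsub>?A\<^esub> S) - c * \<phi> S"])
      show "((\<lambda>\<phi>. \<phi> (c \<odot>\<^bsub>?A\<^esub> S) - c * \<phi> S) \<longlongrightarrow> g (c \<odot>\<^bsub>?A\<^esub> S) - c * g S) (nhds g)"
        by (intro tendsto_diff tendsto_mult tendsto_const ev)
      show "(\<lambda>n. \<Phi> n (c \<odot>\<^bsub>?A\<^esub> S) - c * \<Phi> n S) \<longlonglongrightarrow> 0"
        by (simp add: \<Phi>[OF S] \<Phi>[OF scale_operator_closed[OF p S]] x(1)
            pairing_scale[OF p lp_operator_in_lp[OF S]])
    qed
    then show "g (c \<odot>\<^bsub>?A\<^esub> S) = c * g S" by simp
  next
    fix S assume "S \<in> lp_operators p"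
    moreover have "g S \<in> cball 0 (B S)" using g(1) by (auto simp: D_def PiE_def)
    ultimately show "cmod (g S) \<le> lp_op_norm p S" by (simp add: B_def)
  next
    show "g \<one>\<^bsub>?A\<^esub> = 1"
      by (rule value_eq) (simp add: \<Phi>[OF one_operator_closed[OF p]] x pairing_self[OF p])
  next
    fix K assume K: "K \<in> lp_compact_operators p"
    note Ko = compact_operator_closed[OF p K]
    have norm: "(\<lambda>n. lp_norm p (K (x n))) \<longlonglongrightarrow> 0"
      using x by (intro compact_operator_weakly_null[OF p K _ _ null]) auto
    show "g K = 0"
    proof (rule value_eq, rule Lim_null_comparison[OF always_eventually norm], intro allI)
      show "norm (\<Phi> n K) \<le> lp_norm p (K (x n))" for n
        using cmod_pairing_le[OF p lp_operator_in_lp[OF Ko x(1)] x(1), of n n] x(2) by (simp add: \<Phi>[OF Ko])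
    qed
  qed
  moreover have "g T = l"
    by (rule value_eq) (use lim in \<open>simp add: \<Phi>[OF T]\<close>)
  ultimately show thesis by (rule that)
qed

end

section \<open>The essential numerical range\<close>

theorem theorem3p10:
  fixes p :: real and T :: "(nat \<Rightarrow> complex) \<Rightarrow> (nat \<Rightarrow> complex)"
  assumes "1 < p" and "T \<in> lp_operators p"
  shows "essential_numerical_range p T = alg_numerical_range (calkin_proj p T) (calkin_algebra p)"
proof
  show "essential_numerical_range p T \<subseteq> alg_numerical_range (calkin_proj p T) (calkin_algebra p)"
  proof
    fix l assume "l \<in> essential_numerical_range p T"
    then obtain x where x: "\<And>n. x n \<in> lp p" "\<And>n. lp_norm p (x n) = 1" "lp_weakly_null p x"
        "(\<lambda>n. seq_pairing (T (x n)) (duality_map p (x n))) \<longlonglongrightarrow> l"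
      unfolding essential_numerical_range_def by blast
    obtain g where "calkin_state p g" "g T = l"
      by (rule calkin_state_of_weakly_null[OF assms(1) x(1-3) assms(2) x(4)])
    then show "l \<in> alg_numerical_range (calkin_proj p T) (calkin_algebra p)"
      unfolding calkin_numerical_range[OF assms] by blast
  qed
  show "alg_numerical_range (calkin_proj p T) (calkin_algebra p) \<subseteq> essential_numerical_range p T"
    unfolding calkin_numerical_range[OF assms]
    using calkin_state_in_tail_values[OF assms(1) _ assms(2)] essential_numerical_range_superset[OF assms(1)]
    by blast
qed

end
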